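(* Let $E=(E^0,E^1,r,s)$ be a finite directed graph with no sinks and no sources, and let $n\ge1$. Then $\mathcal{A}(n)$ is unitarily equivalent to the algebra $$\Big(\bigoplus_{x\in E^0}P_x^{(d_E(n,x))}\Big)\,\mathcal{M}_{d_E(n)}\big(\mathcal{T}(E(=\!n))\big)\,\Big(\bigoplus_{x\in E^0}P_x^{(d_E(n,x))}\Big),$$ acting on the space $\bigoplus_{x\in E^0}\big(P_x\mathcal{H}_{E(=n)}\big)^{(d_E(n,x))}$, where $\mathcal{M}_{d_E(n)}(\mathcal{T}(E(=\!n)))$ is the full matrix algebra with entries in $\mathcal{T}(E(=\!n))$ and $P_x$, $x\in E(=\!n)^0=E^0$, are the vertex projections of $\mathcal{T}(E(=\!n))$.
   Context: Graphs and paths. No sinks and no sources means every vertex is $s(e)$ for some edge $e$ and $r(e')$ for some edge $e'$. For a directed graph $F$, $F^*$ is the set of all finite paths, vertices included as paths of length $0$; paths compose right to left ($w_2w_1$, defined when $s(w_2)=r(w_1)$, is $w_1$ followed by $w_2$); $|w|$ is length; $E^{=n}$, $E^{<n}$ are the paths in $E$ of length $n$, respectively less than $n$. Every $w\in E^*$ factors uniquely as $w=w(n)\,v_k\cdots v_1$ with $v_i\in E^{=n}$, $w(n)\in E^{<n}$; this defines $w(n)$. Toeplitz algebra. For a finite graph $F$, $\mathcal{H}_F=\ell^2(F^* )$ has orthonormal basis $\{\xi_w\}_{w\in F^*}$; for $v\in F^*$, $L_v\xi_w=\xi_{vw}$ if $s(v)=r(w)$ and $0$ otherwise; $P_x=L_x$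 for $x\in F^0$; $\mathcal{T}(F)$ is the $C^*$-algebra on $\mathcal{H}_F$ generated by $\{L_w:w\in F^*\}$. The algebra $\mathcal{A}(n)$. A weighted shift on $\mathcal{H}_E$ is a family $(T_e)_{e\in E^1}$ with $T_e\xi_w=\lambda(ew)\xi_{ew}$ (zero if $s(e)\ne r(w)$) for scalars $\lambda(u)$, $u\in E^*\setminus E^0$; it is of period $n$ if $\lambda(ew)$ depends only on $e$ and $w(n)$. $\mathcal{A}(n)\subseteq\mathcal{B}(\mathcal{H}_E)$ is the $C^*$-algebra generated by all $T_e$, $e\in E^1$, from all period $n$ weighted shifts on $\mathcal{H}_E$; equivalently, by the operators $T_{(e,w)}$ ($e\in E^1$, $w\in E^{<n}$, $s(e)=r(w)$) with $T_{(e,w)}\xi_{w'}=\xi_{ew'}$ if $w'(n)=w$ and $0$ otherwise. The graph $E(=\!n)$. $E(=\!n)^0=E^0$, $E(=\!n)^1=\{(w,x):x\in E^0,\ w\in E^{=n},\ s(w)=x\}$, with source of $(w,x)$ equal to $x$ and range $r_E(w)$. Multiplicities. $d_E(n,x)$ is the number of paths in $E$ of length strictly less than $n$ with initial vertex $x$ (source $x$), and $d_E(n)=\sum_{x\in E^0}d_E(n,x)=|E^{<n}|$. $P_x^{(d)}$ denotes the direct sum of $d$ copies of $P_x$ (diagonal matrix), and $K^{(d)}$ the direct sum of $d$ copies of a space $K$. *)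

theory Defs
  imports "HOL-Analysis.Analysis" "Graph_Theory.Arc_Walk"
begin

section \<open>Paths\<close>

text \<open>
  A finite path is its initial vertex together with the list of its edges in order of traversal;
  a vertex \<open>x\<close> is the path \<open>(x, [])\<close>.  The word \<open>e\<^sub>k \<dots> e\<^sub>1\<close> (composition from right to left) is
  thus \<open>(tail e\<^sub>1, [e\<^sub>1, \<dots>, e\<^sub>k])\<close>.  Source is \<open>tail\<close> and range is \<open>head\<close>.
\<close>

type_synonym ('a, 'b) path = "'a \<times> 'b list"

definition paths :: "('a, 'b) pre_digraph \<Rightarrow> ('a, 'b) path set" where
  "paths G = {(u, p). \<exists>v. pre_digraph.awalk G u p v}"

definition psrc :: "('a, 'b) path \<Rightarrow> 'a" where
  "psrc w = fst w"

definition prng :: "('a, 'b) pre_digraph \<Rightarrow> ('a, 'b) path \<Rightarrow> 'a" where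
  "prng G w = pre_digraph.awlast G (fst w) (snd w)"

definition plen :: "('a, 'b) path \<Rightarrow> nat" where
  "plen w = length (snd w)"

text \<open>\<open>pcomp v w\<close> is the product \<open>vw\<close>, i.e. \<open>w\<close> followed by \<open>v\<close>; it is only meaningful if
  \<open>psrc v = prng G w\<close>.\<close>

definition pcomp :: "('a, 'b) path \<Rightarrow> ('a, 'b) path \<Rightarrow> ('a, 'b) path" where
  "pcomp v w = (fst w, snd w @ snd v)"

definition vertex_path :: "'a \<Rightarrow> ('a, 'b) path" where
  "vertex_path x = (x, [])"

definition edge_path :: "('a, 'b) pre_digraph \<Rightarrow> 'b \<Rightarrow> ('a, 'b) path" where
  "edge_path G e = (tail G e, [e])"

definition paths_eq :: "('a, 'b) pre_digraph \<Rightarrow> nat \<Rightarrow> ('a, 'b) path set" where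
  "paths_eq G n = {w \<in> paths G. plen w = n}"

definition paths_lt :: "('a, 'b) pre_digraph \<Rightarrow> nat \<Rightarrow> ('a, 'b) path set" where
  "paths_lt G n = {w \<in> paths G. plen w < n}"

text \<open>\<open>factor_end G n w t\<close>: there is a factorization \<open>w = t v\<^sub>k \<dots> v\<^sub>1\<close> with all \<open>v\<^sub>i\<close> of length \<open>n\<close>
  and \<open>t\<close> of length less than \<open>n\<close>.\<close>

inductive factor_end ::
  "('a, 'b) pre_digraph \<Rightarrow> nat \<Rightarrow> ('a, 'b) path \<Rightarrow> ('a, 'b) path \<Rightarrow> bool"
  for G :: "('a, 'b) pre_digraph" and n :: nat
where
  short: "t \<in> paths_lt G n \<Longrightarrow> factor_end G n t t"
| step: "\<lbrakk>factor_end G n u t; v \<in> paths_eq G n; psrc u = prng G v\<rbrakk>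
    \<Longrightarrow> factor_end G n (pcomp u v) t"

text \<open>The remainder \<open>w(n)\<close>; existence and uniqueness are shown in \<open>factor_end_ex1\<close> below.\<close>

definition path_rem :: "('a, 'b) pre_digraph \<Rightarrow> nat \<Rightarrow> ('a, 'b) path \<Rightarrow> ('a, 'b) path" where
  "path_rem G n w = (THE t. factor_end G n w t)"

definition num_paths_lt :: "('a, 'b) pre_digraph \<Rightarrow> nat \<Rightarrow> 'a \<Rightarrow> nat" where
  "num_paths_lt G n x = card {w \<in> paths_lt G n. psrc w = x}"

definition power_graph ::
  "('a, 'b) pre_digraph \<Rightarrow> nat \<Rightarrow> ('a, ('a, 'b) path \<times> 'a) pre_digraph" where
  "power_graph G n =
    \<lparr>verts = verts G,
     arcs = {(w, x). x \<in> verts G \<and> w \<in> paths_eq G n \<and> psrc w = x},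
     tail = (\<lambda>(w, x). x),
     head = (\<lambda>(w, x). prng G w)\<rparr>"


section \<open>Operators on subspaces of \<open>\<ell>\<^sup>2\<close>\<close>

text \<open>
  A vector is a function from an index type to the complex numbers.  A Hilbert space is given by its
  carrier, a closed subspace of \<open>ell2 I\<close>, where \<open>ell2 I\<close> consists of the square-summable functions
  vanishing outside \<open>I\<close>.  An operator on a carrier \<open>H\<close> is undefined outside \<open>H\<close>, so that
  equality of operators is equality on \<open>H\<close>.
\<close>

definition ell2 :: "'i set \<Rightarrow> ('i \<Rightarrow> complex) set" where
  "ell2 I = {f. (\<forall>i. i \<notin> I \<longrightarrow> f i = 0) \<and> (\<lambda>i. (cmod (f i))\<^sup>2) summable_on UNIV}"

definition l2_inner :: "('i \<Rightarrow> complex) \<Rightarrow> ('i \<Rightarrow> complex) \<Rightarrow> complex" where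
  "l2_inner f g = (\<Sum>\<^sub>\<infinity>i. f i * cnj (g i))"

definition l2_norm :: "('i \<Rightarrow> complex) \<Rightarrow> real" where
  "l2_norm f = sqrt (\<Sum>\<^sub>\<infinity>i. (cmod (f i))\<^sup>2)"

definition basis_vec :: "'i \<Rightarrow> 'i \<Rightarrow> complex" where
  "basis_vec w = (\<lambda>i. if i = w then 1 else 0)"

definition linear_on ::
  "('i \<Rightarrow> complex) set \<Rightarrow> (('i \<Rightarrow> complex) \<Rightarrow> ('j \<Rightarrow> complex)) \<Rightarrow> bool" where
  "linear_on H T \<longleftrightarrow>
    (\<forall>f\<in>H. \<forall>g\<in>H. T (\<lambda>i. f i + g i) = (\<lambda>j. T f j + T g j)) \<and>
    (\<forall>c. \<forall>f\<in>H. T (\<lambda>i. c * f i) = (\<lambda>j. c * T f j))"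

definition bounded_ops ::
  "('i \<Rightarrow> complex) set \<Rightarrow> (('i \<Rightarrow> complex) \<Rightarrow> ('i \<Rightarrow> complex)) set" where
  "bounded_ops H =
    {T \<in> H \<rightarrow>\<^sub>E H. linear_on H T \<and> (\<exists>C. \<forall>f\<in>H. l2_norm (T f) \<le> C * l2_norm f)}"

definition is_adjoint ::
  "('i \<Rightarrow> complex) set \<Rightarrow> (('i \<Rightarrow> complex) \<Rightarrow> ('i \<Rightarrow> complex)) \<Rightarrow>
    (('i \<Rightarrow> complex) \<Rightarrow> ('i \<Rightarrow> complex)) \<Rightarrow> bool" where
  "is_adjoint H T S \<longleftrightarrow> (\<forall>f\<in>H. \<forall>g\<in>H. l2_inner (T f) g = l2_inner f (S g))"

definition zero_op :: "('i \<Rightarrow> complex) set \<Rightarrow> ('i \<Rightarrow> complex) \<Rightarrow> ('i \<Rightarrow> complex)" where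
  "zero_op H = (\<lambda>f\<in>H. \<lambda>i. 0)"

text \<open>Concrete \<open>C\<^sup>*\<close>-algebras (not necessarily unital).  The last condition is closedness in the
  operator norm.\<close>

definition cstar_subalgebra ::
  "('i \<Rightarrow> complex) set \<Rightarrow> (('i \<Rightarrow> complex) \<Rightarrow> ('i \<Rightarrow> complex)) set \<Rightarrow> bool" where
  "cstar_subalgebra H A \<longleftrightarrow>
    A \<subseteq> bounded_ops H \<and>
    zero_op H \<in> A \<and>
    (\<forall>S\<in>A. \<forall>T\<in>A. (\<lambda>f\<in>H. \<lambda>i. S f i + T f i) \<in> A) \<and>
    (\<forall>c. \<forall>T\<in>A. (\<lambda>f\<in>H. \<lambda>i. c * T f i) \<in> A) \<and>
    (\<forall>S\<in>A. \<forall>T\<in>A. compose H S T \<in> A) \<and>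
    (\<forall>T\<in>A. \<forall>S\<in>bounded_ops H. is_adjoint H T S \<longrightarrow> S \<in> A) \<and>
    (\<forall>T\<in>bounded_ops H.
      (\<forall>\<epsilon>>0. \<exists>S\<in>A. \<forall>f\<in>H. l2_norm (\<lambda>i. T f i - S f i) \<le> \<epsilon> * l2_norm f) \<longrightarrow> T \<in> A)"

definition cstar_generated ::
  "('i \<Rightarrow> complex) set \<Rightarrow> (('i \<Rightarrow> complex) \<Rightarrow> ('i \<Rightarrow> complex)) set \<Rightarrow>
    (('i \<Rightarrow> complex) \<Rightarrow> ('i \<Rightarrow> complex)) set" where
  "cstar_generated H S = \<Inter>{A. cstar_subalgebra H A \<and> S \<subseteq> A}"

text \<open>The operator on \<open>ell2 I\<close> with \<open>\<xi>\<^sub>w \<mapsto> \<phi> w\<close> for \<open>w \<in> I\<close>: its matrix has the columns \<open>\<phi> w\<close>.\<close>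

definition column_op ::
  "'i set \<Rightarrow> ('i \<Rightarrow> 'i \<Rightarrow> complex) \<Rightarrow> ('i \<Rightarrow> complex) \<Rightarrow> ('i \<Rightarrow> complex)" where
  "column_op I \<phi> = (\<lambda>f\<in>ell2 I. \<lambda>u. \<Sum>\<^sub>\<infinity>w\<in>I. f w * \<phi> w u)"

definition is_unitary ::
  "('i \<Rightarrow> complex) set \<Rightarrow> ('j \<Rightarrow> complex) set \<Rightarrow>
    (('i \<Rightarrow> complex) \<Rightarrow> ('j \<Rightarrow> complex)) \<Rightarrow> bool" where
  "is_unitary H K U \<longleftrightarrow>
    bij_betw U H K \<and> linear_on H U \<and>
    (\<forall>f\<in>H. \<forall>g\<in>H. l2_inner (U f) (U g) = l2_inner f g)"

definition unitarily_equivalent ::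
  "('i \<Rightarrow> complex) set \<Rightarrow> (('i \<Rightarrow> complex) \<Rightarrow> ('i \<Rightarrow> complex)) set \<Rightarrow>
    ('j \<Rightarrow> complex) set \<Rightarrow> (('j \<Rightarrow> complex) \<Rightarrow> ('j \<Rightarrow> complex)) set \<Rightarrow> bool" where
  "unitarily_equivalent H A K B \<longleftrightarrow>
    (\<exists>U. is_unitary H K U \<and> (\<lambda>T. \<lambda>g\<in>K. U (T (inv_into H U g))) ` A = B)"

text \<open>Direct sum over a finite index set \<open>J\<close>, realized inside \<open>\<ell>\<^sup>2\<close> of pairs: the \<open>j\<close>-th
  component of \<open>h\<close> is \<open>\<lambda>i. h (j, i)\<close>.\<close>

definition direct_sum ::
  "'j set \<Rightarrow> ('j \<Rightarrow> ('i \<Rightarrow> complex) set) \<Rightarrow> ('j \<times> 'i \<Rightarrow> complex) set" where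
  "direct_sum J K =
    {h. (\<forall>j\<in>J. (\<lambda>i. h (j, i)) \<in> K j) \<and> (\<forall>j i. j \<notin> J \<longrightarrow> h (j, i) = 0)}"

text \<open>The operator on the direct sum of copies of \<open>H\<close> with operator matrix \<open>(a j k)\<close>, where
  \<open>j, k \<in> J\<close>.\<close>

definition matrix_op ::
  "'j set \<Rightarrow> ('i \<Rightarrow> complex) set \<Rightarrow> ('j \<Rightarrow> 'j \<Rightarrow> ('i \<Rightarrow> complex) \<Rightarrow> ('i \<Rightarrow> complex)) \<Rightarrow>
    ('j \<times> 'i \<Rightarrow> complex) \<Rightarrow> ('j \<times> 'i \<Rightarrow> complex)" where
  "matrix_op J H a =
    (\<lambda>h\<in>direct_sum J (\<lambda>_. H). \<lambda>(j, i).
      if j \<in> J then \<Sum>k\<in>J. a j k (\<lambda>i'. h (k, i')) i else 0)"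

definition matrix_algebra ::
  "'j set \<Rightarrow> ('i \<Rightarrow> complex) set \<Rightarrow> (('i \<Rightarrow> complex) \<Rightarrow> ('i \<Rightarrow> complex)) set \<Rightarrow>
    (('j \<times> 'i \<Rightarrow> complex) \<Rightarrow> ('j \<times> 'i \<Rightarrow> complex)) set" where
  "matrix_algebra J H A = {matrix_op J H a | a. \<forall>j\<in>J. \<forall>k\<in>J. a j k \<in> A}"

definition diagonal_op ::
  "'j set \<Rightarrow> ('i \<Rightarrow> complex) set \<Rightarrow> ('j \<Rightarrow> ('i \<Rightarrow> complex) \<Rightarrow> ('i \<Rightarrow> complex)) \<Rightarrow>
    ('j \<times> 'i \<Rightarrow> complex) \<Rightarrow> ('j \<times> 'i \<Rightarrow> complex)" where
  "diagonal_op J H D = matrix_op J H (\<lambda>j k. if j = k then D j else zero_op H)"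

text \<open>The compression \<open>Q A Q\<close>, acting on the range \<open>K\<close> of the projection \<open>Q\<close>.\<close>

definition corner ::
  "('i \<Rightarrow> complex) set \<Rightarrow> (('i \<Rightarrow> complex) \<Rightarrow> ('i \<Rightarrow> complex)) \<Rightarrow>
    (('i \<Rightarrow> complex) \<Rightarrow> ('i \<Rightarrow> complex)) set \<Rightarrow> (('i \<Rightarrow> complex) \<Rightarrow> ('i \<Rightarrow> complex)) set" where
  "corner K Q A = (\<lambda>X. \<lambda>h\<in>K. Q (X (Q h))) ` A"


section \<open>The algebras\<close>

definition path_space :: "('a, 'b) pre_digraph \<Rightarrow> (('a, 'b) path \<Rightarrow> complex) set" where
  "path_space G = ell2 (paths G)"

definition creation_op ::
  "('a, 'b) pre_digraph \<Rightarrow> ('a, 'b) path \<Rightarrow>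
    (('a, 'b) path \<Rightarrow> complex) \<Rightarrow> (('a, 'b) path \<Rightarrow> complex)" where
  "creation_op G v =
    column_op (paths G)
      (\<lambda>w. if psrc v = prng G w then basis_vec (pcomp v w) else (\<lambda>_. 0))"

definition vertex_proj ::
  "('a, 'b) pre_digraph \<Rightarrow> 'a \<Rightarrow> (('a, 'b) path \<Rightarrow> complex) \<Rightarrow> (('a, 'b) path \<Rightarrow> complex)" where
  "vertex_proj G x = creation_op G (vertex_path x)"

definition toeplitz_algebra ::
  "('a, 'b) pre_digraph \<Rightarrow> ((('a, 'b) path \<Rightarrow> complex) \<Rightarrow> (('a, 'b) path \<Rightarrow> complex)) set" where
  "toeplitz_algebra G = cstar_generated (path_space G) (creation_op G ` paths G)"

text \<open>The component \<open>T\<^sub>e\<close> of the weighted shift with weights \<open>lam\<close>.\<close>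

definition shift_op ::
  "('a, 'b) pre_digraph \<Rightarrow> (('a, 'b) path \<Rightarrow> complex) \<Rightarrow> 'b \<Rightarrow>
    (('a, 'b) path \<Rightarrow> complex) \<Rightarrow> (('a, 'b) path \<Rightarrow> complex)" where
  "shift_op G lam e =
    column_op (paths G)
      (\<lambda>w. if tail G e = prng G w
           then (\<lambda>u. lam (pcomp (edge_path G e) w) * basis_vec (pcomp (edge_path G e) w) u)
           else (\<lambda>_. 0))"

definition has_period ::
  "('a, 'b) pre_digraph \<Rightarrow> nat \<Rightarrow> (('a, 'b) path \<Rightarrow> complex) \<Rightarrow> bool" where
  "has_period G n lam \<longleftrightarrow>
    (\<forall>e\<in>arcs G. \<forall>w\<in>paths G. \<forall>w'\<in>paths G.
      tail G e = prng G w \<longrightarrow> tail G e = prng G w' \<longrightarrow> path_rem G n w = path_rem G n w' \<longrightarrow>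
      lam (pcomp (edge_path G e) w) = lam (pcomp (edge_path G e) w'))"

definition periodic_shift_algebra ::
  "('a, 'b) pre_digraph \<Rightarrow> nat \<Rightarrow>
    ((('a, 'b) path \<Rightarrow> complex) \<Rightarrow> (('a, 'b) path \<Rightarrow> complex)) set" where
  "periodic_shift_algebra G n =
    cstar_generated (path_space G) {shift_op G lam e | lam e. has_period G n lam \<and> e \<in> arcs G}"

text \<open>Index set of the direct sum over vertices \<open>x\<close> of \<open>d(n,x)\<close> copies; by \<open>card_copies\<close>
  below it has \<open>d(n)\<close> elements, so that matrices indexed by it are the \<open>d(n) \<times> d(n)\<close> matrices.\<close>

definition copies :: "('a, 'b) pre_digraph \<Rightarrow> nat \<Rightarrow> ('a \<times> nat) set" where
  "copies G n = (SIGMA x:verts G. {..<num_paths_lt G n x})"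


section \<open>Well-definedness\<close>

lemma column_op_basis_vec:
  assumes "w \<in> I"
  shows "column_op I \<phi> (basis_vec w) = \<phi> w"
proof -
  have "(\<lambda>i. (cmod (basis_vec w i))\<^sup>2) summable_on UNIV"
    by (rule finite_nonzero_values_imp_summable_on)
      (auto simp: basis_vec_def intro: finite_subset[of _ "{w}"])
  then have "basis_vec w \<in> ell2 I"
    using assms by (auto simp: ell2_def basis_vec_def)
  moreover have "(\<Sum>\<^sub>\<infinity>i\<in>I. basis_vec w i * \<phi> i u) = \<phi> w u" for u
  proof -
    have "(\<Sum>\<^sub>\<infinity>i\<in>I. basis_vec w i * \<phi> i u) = (\<Sum>\<^sub>\<infinity>i\<in>{w}. basis_vec w i * \<phi> i u)"
      using assms by (intro infsum_cong_neutral) (auto simp: basis_vec_def)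
    then show ?thesis by (simp add: basis_vec_def)
  qed
  ultimately show ?thesis by (simp add: column_op_def)
qed

lemma (in wf_digraph) paths_iff: "(u, p) \<in> paths G \<longleftrightarrow> awalk u p (awlast u p)"
  by (auto simp: paths_def)

lemma (in wf_digraph) factor_end_unique:
  assumes "factor_end G n w t"
  shows "t = (awlast (fst w) (take (length (snd w) - length (snd w) mod n) (snd w)),
              drop (length (snd w) - length (snd w) mod n) (snd w))"
  using assms
proof induction
  case (short t)
  then show ?case by (cases t) (auto simp: paths_lt_def plen_def)
next
  case (step u t v)
  obtain a p where v: "v = (a, p)" by (cases v)
  obtain b q where u: "u = (b, q)" by (cases u)
  have p: "awalk a p (awlast a p)" "length p = n"
    using step.hyps v by (auto simp: paths_eq_def plen_def paths_iff)
  have b: "b = awlast a p"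
    using step.hyps u v by (simp add: psrc_def prng_def)
  define m where "m = length q - length q mod n"
  have m: "length (p @ q) - length (p @ q) mod n = n + m"
    using p(2) by (simp add: m_def)
  have "awlast a (p @ take m q) = awlast b (take m q)"
    unfolding b by (auto simp: awalk_verts_conv)
  moreover have "t = (awlast b (take m q), drop m q)"
    using step.IH by (simp add: u m_def)
  moreover have "take (n + m) (p @ q) = p @ take m q" "drop (n + m) (p @ q) = drop m q"
    using p(2) by simp_all
  ultimately show ?case
    unfolding u v pcomp_def fst_conv snd_conv m by simp
qed

lemma (in wf_digraph) factor_end_ex:
  assumes n: "n \<ge> 1"
  shows "(a, p) \<in> paths G \<Longrightarrow> \<exists>t. factor_end G n (a, p) t"
proof (induction "length p" arbitrary: a p rule: less_induct)
  case less
  show ?case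
  proof (cases "length p < n")
    case True
    then show ?thesis
      using less.prems factor_end.short[of "(a, p)" G n] by (auto simp: paths_lt_def plen_def)
  next
    case False
    define b where "b = awlast a (take n p)"
    have w: "awalk a p (awlast a p)"
      using less.prems by (simp add: paths_iff)
    have "awalk a (take n p @ drop n p) (awlast a p)"
      using w by simp
    then have t: "awalk a (take n p) b" and d: "awalk b (drop n p) (awlast a p)"
      unfolding awalk_append_iff b_def by auto
    have "(b, drop n p) \<in> paths G" "(a, take n p) \<in> paths_eq G n"
      using t d False by (auto simp: paths_def paths_eq_def plen_def)
    moreover have "length (drop n p) < length p"
      using n False by simp
    ultimately obtain t where "factor_end G n (b, drop n p) t"
      using less.hyps by blast
    from factor_end.step[OF this \<open>(a, take n p) \<in> paths_eq G n\<close>]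
    have "factor_end G n (a, p) t"
      by (simp add: psrc_def prng_def b_def pcomp_def)
    then show ?thesis ..
  qed
qed

lemma (in wf_digraph) factor_end_ex1:
  assumes "n \<ge> 1" "w \<in> paths G"
  shows "\<exists>!t. factor_end G n w t"
  using factor_end_ex[OF assms(1), of "fst w" "snd w"] assms(2) factor_end_unique
  by (metis prod.collapse)

lemma (in fin_digraph) finite_paths_lt: "finite (paths_lt G n)"
proof (rule finite_subset)
  show "paths_lt G n \<subseteq> verts G \<times> {p. set p \<subseteq> arcs G \<and> length p \<le> n}"
    by (auto simp: paths_lt_def paths_def plen_def awalk_def)
  show "finite (verts G \<times> {p. set p \<subseteq> arcs G \<and> length p \<le> n})"
    by (intro finite_cartesian_product finite_lists_length_le) auto
qed

lemma (in fin_digraph) card_copies: "card (copies G n) = card (paths_lt G n)"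
proof -
  have "paths_lt G n = (\<Union>x\<in>verts G. {w \<in> paths_lt G n. psrc w = x})"
    by (auto simp: paths_lt_def paths_def psrc_def awalk_def)
  also have "card \<dots> = (\<Sum>x\<in>verts G. num_paths_lt G n x)"
    unfolding num_paths_lt_def
    by (rule card_UN_disjoint) (auto intro: finite_subset[OF _ finite_paths_lt])
  finally show ?thesis
    by (simp add: copies_def)
qed

end

theory Submission
  imports Defs
begin

text \<open>
  Write \<open>F\<close> for the power graph and \<open>s\<close> for the source of a path.  A path \<open>w\<close> of \<open>E\<close> factors uniquely as
  \<open>w = t v\<^sub>k \<dots> v\<^sub>1\<close> with \<open>t\<close> of length less than \<open>n\<close> and all \<open>v\<^sub>i\<close> of length \<open>n\<close>, and
  \<open>p = v\<^sub>k \<dots> v\<^sub>1\<close> is a path of \<open>F\<close> with range \<open>s(t)\<close>.  Hence the path space of \<open>E\<close> is the orthogonal sum,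
  over the short paths \<open>t\<close>, of copies of \<open>P\<^bsub>s(t)\<^esub> \<H>\<^sub>F\<close>.  The partial isometry
  \<open>V\<^sub>t : \<xi>\<^sub>p \<mapsto> \<xi>\<^bsub>tp\<^esub>\<close> (\<open>from_component\<close>, with adjoint \<open>component\<close>) embeds the copy with index \<open>t\<close>, and an
  operator \<open>T\<close> becomes the matrix of the operators \<open>V\<^bsub>t'\<^esub>\<^sup>* T V\<^sub>t\<close>.  The heart of the proof is that
  \<open>\<A>(n)\<close> consists of the matrices with all entries in \<open>\<T>(F)\<close>
  (\<open>periodic_shift_algebra_eq_matrices\<close>).  Each inclusion pulls one algebra back along the \<open>V\<^sub>t\<close> or
  their adjoints (\<open>compressed_cstar_subalgebra\<close>) and then only has to look at generators.

  The entries of an element of \<open>\<A>(n)\<close> lie in \<open>\<T>(F)\<close>: since \<open>\<Sum>\<^sub>t V\<^sub>t V\<^sub>t\<^sup>* = 1\<close>, the operators with this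
  property form a C*-algebra.  It contains a periodic shift \<open>T\<^sub>e\<close>, because \<open>T\<^sub>e V\<^sub>t\<close> vanishes unless \<open>et\<close>
  is a path, and then, if \<open>et\<close> factors as \<open>t' p\<close>, periodicity gives \<open>T\<^sub>e V\<^sub>t = \<lambda>(et) V\<^bsub>t'\<^esub> L\<^sub>p\<close>
  (\<open>shift_op_from_component\<close>).

  Conversely \<open>V\<^bsub>t'\<^esub> a V\<^sub>t\<^sup>*\<close> lies in \<open>\<A>(n)\<close> for \<open>a\<close> in \<open>\<T>(F)\<close>: again such \<open>a\<close> form a C*-algebra, now because
  \<open>\<Sum>\<^sub>x V\<^sub>x\<^sup>* V\<^sub>x = 1\<close> over the vertices \<open>x\<close>.  For \<open>a = L\<^sub>v\<close> the operator is \<open>W\<^bsub>t'v\<^esub> W\<^sub>t\<^sup>*\<close> or zero, where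
  \<open>W\<^sub>u \<xi>\<^sub>q = \<xi>\<^bsub>uq\<^esub>\<close> on the paths \<open>q\<close> of length divisible by \<open>n\<close> (\<open>prefix_op\<close>).  Such a \<open>W\<^sub>u\<close> is a product of
  elementary periodic shifts, one for each edge of \<open>u\<close>, applied to \<open>W\<^sub>x\<close> with \<open>x = s(u)\<close>; and
  \<open>W\<^sub>x = W\<^sub>e\<^sup>* W\<^sub>e\<close> for any edge \<open>e\<close> that leaves \<open>x\<close>, which exists because there are no sinks
  (\<open>prefix_op_mem\<close>).

  Finally, numbering the short paths with source \<open>x\<close> by \<open>i < d(n,x)\<close> turns the sequence of components
  into a unitary onto the space of the statement, and a matrix indexed by short paths into an
  element of the corner: compressing by the diagonal projection replaces the entry \<open>a\<close> at \<open>(t', t)\<close> by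
  \<open>P\<^bsub>s(t')\<^esub> a P\<^bsub>s(t)\<^esub>\<close>, which is just what \<open>V\<^bsub>t'\<^esub> a V\<^sub>t\<^sup>*\<close> retains of \<open>a\<close> (\<open>conjugate_matrix\<close>).
\<close>

section \<open>Square-summable functions and bounded operators\<close>

lemma ell2_outside: "f \<in> ell2 I \<Longrightarrow> i \<notin> I \<Longrightarrow> f i = 0"
  by (simp add: ell2_def)

lemma ell2_zero: "(\<lambda>_. 0) \<in> ell2 I"
  by (simp add: ell2_def)

lemma cmod_add_sq_le: "(cmod (a + b))\<^sup>2 \<le> 2 * (cmod a)\<^sup>2 + 2 * (cmod b)\<^sup>2"
proof -
  have "(cmod (a + b))\<^sup>2 \<le> (cmod a + cmod b)\<^sup>2"
    by (simp add: norm_triangle_ineq power_mono)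
  also have "\<dots> \<le> 2 * (cmod a)\<^sup>2 + 2 * (cmod b)\<^sup>2"
    using sum_squares_bound[of "cmod a" "cmod b"] by (simp add: power2_sum)
  finally show ?thesis .
qed

lemma ell2_add_aux:
  assumes "f \<in> ell2 I" "g \<in> ell2 I"
  shows "(\<lambda>i. 2 * (cmod (f i))\<^sup>2 + 2 * (cmod (g i))\<^sup>2) summable_on UNIV"
  using assms by (auto simp: ell2_def intro!: summable_on_add summable_on_cmult_right)

lemma ell2_add:
  assumes "f \<in> ell2 I" "g \<in> ell2 I"
  shows "(\<lambda>i. f i + g i) \<in> ell2 I"
proof -
  have "(\<lambda>i. (cmod (f i + g i))\<^sup>2) summable_on UNIV"
    by (rule summable_on_comparison_test[OF ell2_add_aux[OF assms]]) (auto intro: cmod_add_sq_le)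
  then show ?thesis using assms by (auto simp: ell2_def)
qed

lemma ell2_scale:
  assumes "f \<in> ell2 I"
  shows "(\<lambda>i. c * f i) \<in> ell2 I"
proof -
  have "(\<lambda>i. (cmod c)\<^sup>2 * (cmod (f i))\<^sup>2) summable_on UNIV"
    using assms by (intro summable_on_cmult_right) (auto simp: ell2_def)
  then show ?thesis using assms by (auto simp: ell2_def norm_mult power_mult_distrib)
qed

lemma ell2_sum:
  assumes "\<And>j. j \<in> J \<Longrightarrow> f j \<in> ell2 I"
  shows "(\<lambda>i. \<Sum>j\<in>J. f j i) \<in> ell2 I"
  using assms by (induction J rule: infinite_finite_induct) (auto intro: ell2_zero ell2_add)

lemma l2_norm_nonneg: "l2_norm f \<ge> 0"
  by (simp add: l2_norm_def infsum_nonneg)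

lemma l2_norm_scale: "l2_norm (\<lambda>i. c * f i) = cmod c * l2_norm f"
  by (simp add: l2_norm_def norm_mult power_mult_distrib infsum_cmult_right' real_sqrt_mult)

text \<open>The factor 2 replaces the Cauchy--Schwarz inequality by
  \<open>(a + b)\<^sup>2 \<le> 2 a\<^sup>2 + 2 b\<^sup>2\<close>; it is good enough to see that sums of bounded operators are bounded.\<close>

lemma l2_norm_add_le:
  assumes "f \<in> ell2 I" "g \<in> ell2 I"
  shows "l2_norm (\<lambda>i. f i + g i) \<le> 2 * (l2_norm f + l2_norm g)"
proof -
  define a b where "a = (\<Sum>\<^sub>\<infinity>i. (cmod (f i))\<^sup>2)" and "b = (\<Sum>\<^sub>\<infinity>i. (cmod (g i))\<^sup>2)"
  have ab: "a \<ge> 0" "b \<ge> 0" by (simp_all add: a_def b_def infsum_nonneg)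
  have s: "(\<lambda>i. (cmod (f i))\<^sup>2) summable_on UNIV" "(\<lambda>i. (cmod (g i))\<^sup>2) summable_on UNIV"
    "(\<lambda>i. (cmod (f i + g i))\<^sup>2) summable_on UNIV"
    using assms ell2_add[OF assms] by (auto simp: ell2_def)
  have "(\<Sum>\<^sub>\<infinity>i. (cmod (f i + g i))\<^sup>2) \<le> (\<Sum>\<^sub>\<infinity>i. 2 * (cmod (f i))\<^sup>2 + 2 * (cmod (g i))\<^sup>2)"
    using s(3) ell2_add_aux[OF assms] by (rule infsum_mono) (rule cmod_add_sq_le)
  also have "\<dots> = 2 * a + 2 * b"
    using s by (simp add: a_def b_def infsum_add infsum_cmult_right' summable_on_cmult_right)
  also have "\<dots> \<le> (2 * (sqrt a + sqrt b))\<^sup>2"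
    using ab by (simp add: power_mult_distrib power2_sum)
  finally show ?thesis
    unfolding l2_norm_def a_def[symmetric] b_def[symmetric]
    by (rule real_le_lsqrt[rotated -1]) (use ab in auto)
qed

lemma linear_onD:
  assumes "linear_on H T"
  shows "\<And>f g. f \<in> H \<Longrightarrow> g \<in> H \<Longrightarrow> T (\<lambda>i. f i + g i) = (\<lambda>j. T f j + T g j)"
    "\<And>c f. f \<in> H \<Longrightarrow> T (\<lambda>i. c * f i) = (\<lambda>j. c * T f j)"
  using assms unfolding linear_on_def by auto

lemma linear_on_sum:
  assumes "linear_on (ell2 I) T" "\<And>j. j \<in> J \<Longrightarrow> f j \<in> ell2 I"
  shows "T (\<lambda>i. \<Sum>j\<in>J. f j i) = (\<lambda>k. \<Sum>j\<in>J. T (f j) k)"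
proof -
  have z: "T (\<lambda>i. 0) = (\<lambda>k. 0)"
    using linear_onD(2)[OF assms(1) ell2_zero, of 0] by simp
  show ?thesis
    using assms(2)
  proof (induction J rule: infinite_finite_induct)
    case (insert j J)
    have a: "T (\<lambda>i. f j i + (\<Sum>j\<in>J. f j i)) = (\<lambda>k. T (f j) k + T (\<lambda>i. \<Sum>j\<in>J. f j i) k)"
      using insert.prems by (intro linear_onD(1)[OF assms(1)] ell2_sum) auto
    show ?case
      using insert a by simp
  qed (simp_all add: z)
qed

lemma bounded_opsI:
  assumes "\<And>f. f \<in> H \<Longrightarrow> T f \<in> H" "\<And>f. f \<notin> H \<Longrightarrow> T f = undefined" "linear_on H T"
    "\<And>f. f \<in> H \<Longrightarrow> l2_norm (T f) \<le> C * l2_norm f"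
  shows "T \<in> bounded_ops H"
  using assms unfolding bounded_ops_def by (auto simp: PiE_def extensional_def)

lemma bounded_opsD:
  assumes "T \<in> bounded_ops H"
  shows "\<And>f. f \<in> H \<Longrightarrow> T f \<in> H" "\<And>f. f \<notin> H \<Longrightarrow> T f = undefined" "linear_on H T"
  using assms unfolding bounded_ops_def by (auto simp: PiE_def extensional_def)

lemma bounded_ops_bound:
  assumes "T \<in> bounded_ops H"
  obtains C where "C \<ge> 0" "\<forall>f\<in>H. l2_norm (T f) \<le> C * l2_norm f"
proof -
  obtain C where C: "\<forall>f\<in>H. l2_norm (T f) \<le> C * l2_norm f"
    using assms unfolding bounded_ops_def by auto
  have "l2_norm (T f) \<le> \<bar>C\<bar> * l2_norm f" if "f \<in> H" for f
    using C that mult_right_mono[of C "\<bar>C\<bar>" "l2_norm f"] l2_norm_nonneg[of f] by force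
  then show ?thesis using that[of "\<bar>C\<bar>"] by simp
qed

lemma linear_on_diff:
  assumes "linear_on (ell2 I) T" "f \<in> ell2 I" "g \<in> ell2 I"
  shows "T (\<lambda>i. f i - g i) = (\<lambda>j. T f j - T g j)"
proof -
  have "T (\<lambda>i. f i + (-1) * g i) = (\<lambda>j. T f j + T (\<lambda>i. (-1) * g i) j)"
    by (rule linear_onD(1)[OF assms(1,2) ell2_scale[OF assms(3)]])
  also have "T (\<lambda>i. (-1) * g i) = (\<lambda>j. (-1) * T g j)"
    by (rule linear_onD(2)[OF assms(1,3)])
  finally show ?thesis by simp
qed

lemma linear_onI:
  assumes "\<And>f g. f \<in> H \<Longrightarrow> g \<in> H \<Longrightarrow> T (\<lambda>i. f i + g i) = (\<lambda>j. T f j + T g j)"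
    "\<And>c f. f \<in> H \<Longrightarrow> T (\<lambda>i. c * f i) = (\<lambda>j. c * T f j)"
  shows "linear_on H T"
  using assms unfolding linear_on_def by auto

lemma zero_op_bounded: "zero_op (ell2 I) \<in> bounded_ops (ell2 I)"
  by (rule bounded_opsI[where C = 0])
    (auto simp: zero_op_def ell2_zero l2_norm_def intro!: linear_onI ell2_add ell2_scale)

lemma add_bounded:
  assumes "S \<in> bounded_ops (ell2 I)" "T \<in> bounded_ops (ell2 I)"
  shows "(\<lambda>f\<in>ell2 I. \<lambda>i. S f i + T f i) \<in> bounded_ops (ell2 I)"
proof -
  obtain C where C: "C \<ge> 0" "\<forall>f\<in>ell2 I. l2_norm (S f) \<le> C * l2_norm f"
    using bounded_ops_bound[OF assms(1)] by blast
  obtain D where D: "D \<ge> 0" "\<forall>f\<in>ell2 I. l2_norm (T f) \<le> D * l2_norm f"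
    using bounded_ops_bound[OF assms(2)] by blast
  note S = bounded_opsD[OF assms(1)] and T = bounded_opsD[OF assms(2)]
  show ?thesis
  proof (rule bounded_opsI[where C = "2 * (C + D)"])
    show "linear_on (ell2 I) (\<lambda>f\<in>ell2 I. \<lambda>i. S f i + T f i)"
      by (rule linear_onI)
        (simp_all add: ell2_add ell2_scale linear_onD[OF S(3)] linear_onD[OF T(3)] algebra_simps)
    fix f assume f: "f \<in> ell2 I"
    show "l2_norm ((\<lambda>f\<in>ell2 I. \<lambda>i. S f i + T f i) f) \<le> 2 * (C + D) * l2_norm f"
      using l2_norm_add_le[OF S(1)[OF f] T(1)[OF f]] C(2)[rule_format, OF f] D(2)[rule_format, OF f] f
      by (simp add: algebra_simps)
  qed (auto intro: ell2_add S(1) T(1))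
qed

lemma scale_bounded:
  assumes "T \<in> bounded_ops (ell2 I)"
  shows "(\<lambda>f\<in>ell2 I. \<lambda>i. c * T f i) \<in> bounded_ops (ell2 I)"
proof -
  obtain D where D: "D \<ge> 0" "\<forall>f\<in>ell2 I. l2_norm (T f) \<le> D * l2_norm f"
    using bounded_ops_bound[OF assms] by blast
  note T = bounded_opsD[OF assms]
  show ?thesis
  proof (rule bounded_opsI[where C = "cmod c * D"])
    show "linear_on (ell2 I) (\<lambda>f\<in>ell2 I. \<lambda>i. c * T f i)"
      by (rule linear_onI)
        (simp_all add: ell2_add ell2_scale linear_onD[OF T(3)] algebra_simps)
    fix f assume f: "f \<in> ell2 I"
    show "l2_norm ((\<lambda>f\<in>ell2 I. \<lambda>i. c * T f i) f) \<le> cmod c * D * l2_norm f"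
      using mult_left_mono[OF D(2)[rule_format, OF f] norm_ge_zero[of c]] f
      by (simp add: l2_norm_scale mult.assoc)
  qed (auto intro: ell2_scale T(1))
qed

lemma compose_bounded:
  assumes "S \<in> bounded_ops (ell2 I)" "T \<in> bounded_ops (ell2 I)"
  shows "compose (ell2 I) S T \<in> bounded_ops (ell2 I)"
proof -
  obtain C where C: "C \<ge> 0" "\<forall>f\<in>ell2 I. l2_norm (S f) \<le> C * l2_norm f"
    using bounded_ops_bound[OF assms(1)] by blast
  obtain D where D: "D \<ge> 0" "\<forall>f\<in>ell2 I. l2_norm (T f) \<le> D * l2_norm f"
    using bounded_ops_bound[OF assms(2)] by blast
  note S = bounded_opsD[OF assms(1)] and T = bounded_opsD[OF assms(2)]
  show ?thesis
  proof (rule bounded_opsI[where C = "C * D"])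
    show "linear_on (ell2 I) (compose (ell2 I) S T)"
      using S(1,3) T(1,3)
      by (intro linear_onI) (simp_all add: compose_def ell2_add ell2_scale linear_onD)
    fix f assume f: "f \<in> ell2 I"
    show "l2_norm (compose (ell2 I) S T f) \<le> C * D * l2_norm f"
      using C(2)[rule_format, of "T f"] T(1)[OF f] mult_left_mono[OF D(2)[rule_format, OF f] C(1)] f
      by (simp add: compose_def mult.assoc)
  qed (use S(1) T(1) in \<open>auto simp: compose_def\<close>)
qed

section \<open>Concrete C*-algebras\<close>

lemma cstar_subalgebraD:
  assumes "cstar_subalgebra H A"
  shows "A \<subseteq> bounded_ops H" "zero_op H \<in> A"
    "\<And>S T. S \<in> A \<Longrightarrow> T \<in> A \<Longrightarrow> (\<lambda>f\<in>H. \<lambda>i. S f i + T f i) \<in> A"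
    "\<And>c T. T \<in> A \<Longrightarrow> (\<lambda>f\<in>H. \<lambda>i. c * T f i) \<in> A"
    "\<And>S T. S \<in> A \<Longrightarrow> T \<in> A \<Longrightarrow> compose H S T \<in> A"
    "\<And>S T. T \<in> A \<Longrightarrow> S \<in> bounded_ops H \<Longrightarrow> is_adjoint H T S \<Longrightarrow> S \<in> A"
    "\<And>T. T \<in> bounded_ops H \<Longrightarrow>
      (\<And>\<epsilon>. \<epsilon> > 0 \<Longrightarrow> \<exists>S\<in>A. \<forall>f\<in>H. l2_norm (\<lambda>i. T f i - S f i) \<le> \<epsilon> * l2_norm f) \<Longrightarrow> T \<in> A"
  using assms unfolding cstar_subalgebra_def by blast+

lemma cstar_bounded_ops: "cstar_subalgebra (ell2 I) (bounded_ops (ell2 I))"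
  unfolding cstar_subalgebra_def
  by (intro conjI ballI allI impI subset_refl)
    (auto intro: zero_op_bounded add_bounded scale_bounded compose_bounded)

text \<open>Boundedness of the generators makes the intersection that defines the generated algebra one
  over a nonempty family; each closure property then passes to the intersection.\<close>

lemma cstar_generated_subalgebra:
  assumes "S \<subseteq> bounded_ops (ell2 I)"
  shows "cstar_subalgebra (ell2 I) (cstar_generated (ell2 I) S)"
proof -
  let ?F = "{A. cstar_subalgebra (ell2 I) A \<and> S \<subseteq> A}"
  have m: "bounded_ops (ell2 I) \<in> ?F" using assms cstar_bounded_ops by auto
  have d: "A \<in> ?F \<Longrightarrow> cstar_subalgebra (ell2 I) A" for A by auto
  note D = cstar_subalgebraD[OF d]
  define C where "C = \<Inter>?F"
  show ?thesis
    unfolding cstar_generated_def C_def[symmetric] unfolding cstar_subalgebra_def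
  proof (intro conjI ballI allI impI)
    show "C \<subseteq> bounded_ops (ell2 I)" using m unfolding C_def by blast
  next
    show "zero_op (ell2 I) \<in> C" using D(2) unfolding C_def by blast
  next
    fix S T assume "S \<in> C" "T \<in> C"
    then show "(\<lambda>f\<in>ell2 I. \<lambda>i. S f i + T f i) \<in> C" "compose (ell2 I) S T \<in> C"
      using D(3,5) unfolding C_def by blast+
  next
    fix c T assume "T \<in> C"
    then show "(\<lambda>f\<in>ell2 I. \<lambda>i. c * T f i) \<in> C" using D(4) unfolding C_def by blast
  next
    fix S T assume "T \<in> C" "S \<in> bounded_ops (ell2 I)" "is_adjoint (ell2 I) T S"
    then show "S \<in> C" using D(6) unfolding C_def by blast
  next
    fix T assume T: "T \<in> bounded_ops (ell2 I)"
      "\<forall>\<epsilon>>0. \<exists>S\<in>C. \<forall>f\<in>ell2 I. l2_norm (\<lambda>i. T f i - S f i) \<le> \<epsilon> * l2_norm f"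
    show "T \<in> C"
      unfolding C_def
    proof
      fix A assume A: "A \<in> ?F"
      show "T \<in> A"
      proof (rule D(7)[OF A T(1)])
        fix \<epsilon> :: real assume "\<epsilon> > 0"
        then show "\<exists>S\<in>A. \<forall>f\<in>ell2 I. l2_norm (\<lambda>i. T f i - S f i) \<le> \<epsilon> * l2_norm f"
          using T(2) A unfolding C_def by blast
      qed
    qed
  qed
qed

lemma cstar_generated_superset: "S \<subseteq> cstar_generated H S"
  unfolding cstar_generated_def by blast

lemma cstar_generated_minimal:
  assumes "cstar_subalgebra H A" "S \<subseteq> A"
  shows "cstar_generated H S \<subseteq> A"
  using assms unfolding cstar_generated_def by blast

lemma cstar_sum:
  assumes "cstar_subalgebra H A" "\<And>j. j \<in> J \<Longrightarrow> T j \<in> A"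
  shows "(\<lambda>f\<in>H. \<lambda>i. \<Sum>j\<in>J. T j f i) \<in> A"
  using assms(2)
proof (induction J rule: infinite_finite_induct)
  case (insert j J)
  have "(\<lambda>f\<in>H. \<lambda>i. T j f i + (\<lambda>f\<in>H. \<lambda>i. \<Sum>j\<in>J. T j f i) f i) \<in> A"
    using insert by (intro cstar_subalgebraD(3)[OF assms(1)]) auto
  also have "(\<lambda>f\<in>H. \<lambda>i. T j f i + (\<lambda>f\<in>H. \<lambda>i. \<Sum>j\<in>J. T j f i) f i)
      = (\<lambda>f\<in>H. \<lambda>i. \<Sum>j\<in>insert j J. T j f i)"
    using insert by (auto simp: restrict_def fun_eq_iff)
  finally show ?case .
qed (use cstar_subalgebraD(2)[OF assms(1)] in \<open>simp_all add: zero_op_def\<close>)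

section \<open>Pulling a C*-algebra back along a family of contractions\<close>

text \<open>Operators between two different spaces, such as the \<open>V\<^sub>t\<close>, have adjoints that cannot be expressed
  by the predicate for operators on one space.\<close>

definition adjoint_contractions ::
  "('i \<Rightarrow> complex) set \<Rightarrow> ('j \<Rightarrow> complex) set \<Rightarrow>
    (('i \<Rightarrow> complex) \<Rightarrow> ('j \<Rightarrow> complex)) \<Rightarrow> (('j \<Rightarrow> complex) \<Rightarrow> ('i \<Rightarrow> complex)) \<Rightarrow> bool" where
  "adjoint_contractions H G R R' \<longleftrightarrow>
    R \<in> H \<rightarrow> G \<and> R' \<in> G \<rightarrow> H \<and> linear_on H R \<and> linear_on G R' \<and>
    (\<forall>f\<in>H. l2_norm (R f) \<le> l2_norm f) \<and> (\<forall>g\<in>G. l2_norm (R' g) \<le> l2_norm g) \<and>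
    (\<forall>f\<in>H. \<forall>g\<in>G. l2_inner (R f) g = l2_inner f (R' g)) \<and>
    (\<forall>f\<in>H. \<forall>g\<in>G. l2_inner (R' g) f = l2_inner g (R f))"

lemma adjoint_contractionsD:
  assumes "adjoint_contractions H G R R'"
  shows "\<And>f. f \<in> H \<Longrightarrow> R f \<in> G" "\<And>g. g \<in> G \<Longrightarrow> R' g \<in> H" "linear_on H R" "linear_on G R'"
    "\<And>f. f \<in> H \<Longrightarrow> l2_norm (R f) \<le> l2_norm f" "\<And>g. g \<in> G \<Longrightarrow> l2_norm (R' g) \<le> l2_norm g"
    "\<And>f g. f \<in> H \<Longrightarrow> g \<in> G \<Longrightarrow> l2_inner (R f) g = l2_inner f (R' g)"
    "\<And>f g. f \<in> H \<Longrightarrow> g \<in> G \<Longrightarrow> l2_inner (R' g) f = l2_inner g (R f)"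
  using assms unfolding adjoint_contractions_def by auto

lemma adjoint_contractions_sym:
  "adjoint_contractions H G R R' \<Longrightarrow> adjoint_contractions G H R' R"
  unfolding adjoint_contractions_def by blast

lemma compression_bounded:
  assumes "adjoint_contractions (ell2 I) (ell2 M) R R'" "adjoint_contractions (ell2 I) (ell2 M) S S'"
    and "T \<in> bounded_ops (ell2 I)"
  shows "(\<lambda>g\<in>ell2 M. R (T (S' g))) \<in> bounded_ops (ell2 M)"
proof -
  note R = adjoint_contractionsD[OF assms(1)] and S = adjoint_contractionsD[OF assms(2)]
    and T = bounded_opsD[OF assms(3)]
  obtain C where C: "C \<ge> 0" "\<forall>f\<in>ell2 I. l2_norm (T f) \<le> C * l2_norm f"
    using bounded_ops_bound[OF assms(3)] by blast
  show ?thesis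
  proof (rule bounded_opsI[where C = C])
    show "linear_on (ell2 M) (\<lambda>g\<in>ell2 M. R (T (S' g)))"
      by (rule linear_onI)
        (simp_all add: ell2_add ell2_scale linear_onD[OF R(3)] linear_onD[OF S(4)]
          linear_onD[OF T(3)] S(2) T(1))
    fix f assume f: "f \<in> ell2 M"
    have "l2_norm (R (T (S' f))) \<le> l2_norm (T (S' f))"
      by (intro R(5) T(1) S(2) f)
    also have "\<dots> \<le> C * l2_norm (S' f)"
      using C(2) S(2)[OF f] by blast
    also have "\<dots> \<le> C * l2_norm f"
      by (intro mult_left_mono C(1) S(6) f)
    finally show "l2_norm ((\<lambda>g\<in>ell2 M. R (T (S' g))) f) \<le> C * l2_norm f"
      using f by simp
  qed (auto intro: R(1) S(2) T(1))
qed

text \<open>The resolution of the identity is what makes the set closed under products: inserted between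
  two factors it gives \<open>R\<^sub>j S T R\<^sub>k\<^sup>* = \<Sum>\<^sub>l (R\<^sub>j S R\<^sub>l\<^sup>*) (R\<^sub>l T R\<^sub>k\<^sup>*)\<close>.  It may run over a part \<open>J0\<close> of the
  index set, since the vertices already resolve the identity of the path space of the power graph
  while all short paths do so for \<open>E\<close>.  Adjoints are taken with \<open>j\<close> and \<open>k\<close> exchanged, and norm limits
  pass to the entries because the \<open>R\<^sub>j\<close> are contractions.\<close>

lemma compressed_cstar_subalgebra:
  assumes A: "cstar_subalgebra (ell2 M) A"
    and R: "\<And>j. j \<in> J \<Longrightarrow> adjoint_contractions (ell2 I) (ell2 M) (R j) (R' j)"
    and J0: "J0 \<subseteq> J"
    and unit: "\<And>f. f \<in> ell2 I \<Longrightarrow> (\<lambda>i. \<Sum>j\<in>J0. R' j (R j f) i) = f"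
  shows "cstar_subalgebra (ell2 I)
    {T \<in> bounded_ops (ell2 I). \<forall>j\<in>J. \<forall>k\<in>J. (\<lambda>g\<in>ell2 M. R j (T (R' k g))) \<in> A}"
    (is "cstar_subalgebra _ ?B")
proof -
  note R' = adjoint_contractionsD[OF R]
  note D = cstar_subalgebraD[OF A]
  have ops: "S f \<in> ell2 I" if "S \<in> ?B" "f \<in> ell2 I" for S f
    using that bounded_opsD(1) by blast
  have memI: "T \<in> ?B" if "T \<in> bounded_ops (ell2 I)"
    "\<And>j k. j \<in> J \<Longrightarrow> k \<in> J \<Longrightarrow> (\<lambda>g\<in>ell2 M. R j (T (R' k g))) \<in> A" for T
    using that by auto
  have memD: "(\<lambda>g\<in>ell2 M. R j (T (R' k g))) \<in> A" if "T \<in> ?B" "j \<in> J" "k \<in> J" for T j k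
    using that by blast
  show ?thesis
    unfolding cstar_subalgebra_def
  proof (intro conjI ballI allI impI)
    show "?B \<subseteq> bounded_ops (ell2 I)" by auto
  next
    have z: "R j (\<lambda>_. 0) = (\<lambda>_. 0)" if "j \<in> J" for j
      using linear_on_sum[OF R'(3)[OF that], of "{}"] by simp
    show "zero_op (ell2 I) \<in> ?B"
      using D(2) by (intro memI zero_op_bounded) (simp add: zero_op_def R'(2) z cong: restrict_cong)
  next
    fix S T assume S: "S \<in> ?B" and T: "T \<in> ?B"
    show "(\<lambda>f\<in>ell2 I. \<lambda>i. S f i + T f i) \<in> ?B"
    proof (rule memI)
      show "(\<lambda>f\<in>ell2 I. \<lambda>i. S f i + T f i) \<in> bounded_ops (ell2 I)"
        using S T by (auto intro: add_bounded)
      fix j k assume jk: "j \<in> J" "k \<in> J"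
      have "(\<lambda>g\<in>ell2 M. \<lambda>i. (\<lambda>g\<in>ell2 M. R j (S (R' k g))) g i + (\<lambda>g\<in>ell2 M. R j (T (R' k g))) g i) \<in> A"
        by (intro D(3) memD[OF S] memD[OF T] jk)
      also have "(\<lambda>g\<in>ell2 M. \<lambda>i. (\<lambda>g\<in>ell2 M. R j (S (R' k g))) g i + (\<lambda>g\<in>ell2 M. R j (T (R' k g))) g i)
          = (\<lambda>g\<in>ell2 M. R j ((\<lambda>f\<in>ell2 I. \<lambda>i. S f i + T f i) (R' k g)))"
        using ops[OF S] ops[OF T] jk
          by (intro restrict_ext) (simp add: R'(2) linear_onD[OF R'(3)])
      finally show "(\<lambda>g\<in>ell2 M. R j ((\<lambda>f\<in>ell2 I. \<lambda>i. S f i + T f i) (R' k g))) \<in> A" .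
    qed
    show "compose (ell2 I) S T \<in> ?B"
    proof (rule memI)
      show "compose (ell2 I) S T \<in> bounded_ops (ell2 I)"
        using S T by (auto intro: compose_bounded)
      fix j k assume jk: "j \<in> J" "k \<in> J"
      \<comment> \<open>The summand with index \<open>l\<close> of the product of the two operator matrices.\<close>
      let ?C = "\<lambda>l. compose (ell2 M) (\<lambda>g\<in>ell2 M. R j (S (R' l g))) (\<lambda>g\<in>ell2 M. R l (T (R' k g)))"
      have "(\<lambda>g\<in>ell2 M. \<lambda>i. \<Sum>l\<in>J0. ?C l g i) \<in> A"
        using J0 by (intro cstar_sum[OF A] D(5) memD[OF S] memD[OF T] jk) auto
      also have "(\<lambda>g\<in>ell2 M. \<lambda>i. \<Sum>l\<in>J0. ?C l g i)
          = (\<lambda>g\<in>ell2 M. R j (compose (ell2 I) S T (R' k g)))"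
      proof (rule restrict_ext)
        fix g assume g: "g \<in> ell2 M"
        let ?f = "T (R' k g)"
        have f: "?f \<in> ell2 I" by (intro ops[OF T] R'(2) jk g)
        have lS: "linear_on (ell2 I) S" and rS: "\<And>f. f \<in> ell2 I \<Longrightarrow> S f \<in> ell2 I"
          using S bounded_opsD by blast+
        have l: "R' l (R l ?f) \<in> ell2 I" if "l \<in> J0" for l
          using that J0 f R'(1,2) by blast
        have "R j (S ?f) = R j (S (\<lambda>i. \<Sum>l\<in>J0. R' l (R l ?f) i))"
          by (simp add: unit[OF f])
        also have "\<dots> = R j (\<lambda>i. \<Sum>l\<in>J0. S (R' l (R l ?f)) i)"
          by (subst linear_on_sum[OF lS]) (auto intro: l)
        also have "\<dots> = (\<lambda>i. \<Sum>l\<in>J0. R j (S (R' l (R l ?f))) i)"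
          by (subst linear_on_sum[OF R'(3)[OF jk(1)]]) (auto intro: l rS)
        finally show "(\<lambda>i. \<Sum>l\<in>J0. ?C l g i) = R j (compose (ell2 I) S T (R' k g))"
          using g f jk J0 R'(1,2) by (simp add: compose_def subset_iff)
      qed
      finally show "(\<lambda>g\<in>ell2 M. R j (compose (ell2 I) S T (R' k g))) \<in> A" .
    qed
  next
    fix c T assume T: "T \<in> ?B"
    show "(\<lambda>f\<in>ell2 I. \<lambda>i. c * T f i) \<in> ?B"
    proof (rule memI)
      show "(\<lambda>f\<in>ell2 I. \<lambda>i. c * T f i) \<in> bounded_ops (ell2 I)"
        using T by (auto intro: scale_bounded)
      fix j k assume jk: "j \<in> J" "k \<in> J"
      have "(\<lambda>g\<in>ell2 M. \<lambda>i. c * (\<lambda>g\<in>ell2 M. R j (T (R' k g))) g i) \<in> A"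
        by (intro D(4) memD[OF T] jk)
      also have "(\<lambda>g\<in>ell2 M. \<lambda>i. c * (\<lambda>g\<in>ell2 M. R j (T (R' k g))) g i)
          = (\<lambda>g\<in>ell2 M. R j ((\<lambda>f\<in>ell2 I. \<lambda>i. c * T f i) (R' k g)))"
        using ops[OF T] jk
          by (intro restrict_ext) (simp add: R'(2) linear_onD[OF R'(3)])
      finally show "(\<lambda>g\<in>ell2 M. R j ((\<lambda>f\<in>ell2 I. \<lambda>i. c * T f i) (R' k g))) \<in> A" .
    qed
  next
    fix T S assume T: "T \<in> ?B" and S: "S \<in> bounded_ops (ell2 I)" and a: "is_adjoint (ell2 I) T S"
    show "S \<in> ?B"
    proof (rule memI[OF S])
      fix j k assume jk: "j \<in> J" "k \<in> J"
      show "(\<lambda>g\<in>ell2 M. R j (S (R' k g))) \<in> A"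
      proof (rule D(6))
        show "(\<lambda>g\<in>ell2 M. R k (T (R' j g))) \<in> A" by (rule memD[OF T jk(2,1)])
        show "(\<lambda>g\<in>ell2 M. R j (S (R' k g))) \<in> bounded_ops (ell2 M)"
          by (intro compression_bounded[OF R R S] jk)
        show "is_adjoint (ell2 M) (\<lambda>g\<in>ell2 M. R k (T (R' j g))) (\<lambda>g\<in>ell2 M. R j (S (R' k g)))"
          unfolding is_adjoint_def
        proof (intro ballI)
          fix f g assume fg: "f \<in> ell2 M" "g \<in> ell2 M"
          have TR: "T (R' j f) \<in> ell2 I" and SR: "S (R' k g) \<in> ell2 I"
            by (intro ops[OF T] bounded_opsD(1)[OF S] R'(2) jk fg)+
          have "l2_inner (R k (T (R' j f))) g = l2_inner (T (R' j f)) (R' k g)"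
            by (rule R'(7)[OF jk(2) TR fg(2)])
          also have "\<dots> = l2_inner (R' j f) (S (R' k g))"
            using a fg jk unfolding is_adjoint_def by (simp add: R'(2))
          also have "\<dots> = l2_inner f (R j (S (R' k g)))"
            by (rule R'(8)[OF jk(1) SR fg(1)])
          finally show "l2_inner ((\<lambda>g\<in>ell2 M. R k (T (R' j g))) f) g
              = l2_inner f ((\<lambda>g\<in>ell2 M. R j (S (R' k g))) g)"
            using fg by simp
        qed
      qed
    qed
  next
    fix T assume T: "T \<in> bounded_ops (ell2 I)"
      and lim: "\<forall>\<epsilon>>0. \<exists>S\<in>?B. \<forall>f\<in>ell2 I. l2_norm (\<lambda>i. T f i - S f i) \<le> \<epsilon> * l2_norm f"
    show "T \<in> ?B"
    proof (rule memI[OF T])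
      fix j k assume jk: "j \<in> J" "k \<in> J"
      show "(\<lambda>g\<in>ell2 M. R j (T (R' k g))) \<in> A"
      proof (rule D(7))
        show "(\<lambda>g\<in>ell2 M. R j (T (R' k g))) \<in> bounded_ops (ell2 M)"
          by (intro compression_bounded[OF R R T] jk)
        fix \<epsilon> :: real assume e: "\<epsilon> > 0"
        then obtain S where S: "S \<in> ?B"
          "\<And>f. f \<in> ell2 I \<Longrightarrow> l2_norm (\<lambda>i. T f i - S f i) \<le> \<epsilon> * l2_norm f"
          using lim by blast
        show "\<exists>S\<in>A. \<forall>f\<in>ell2 M. l2_norm (\<lambda>i. (\<lambda>g\<in>ell2 M. R j (T (R' k g))) f i - S f i) \<le> \<epsilon> * l2_norm f"
        proof (intro bexI[of _ "\<lambda>g\<in>ell2 M. R j (S (R' k g))"] ballI)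
          show "(\<lambda>g\<in>ell2 M. R j (S (R' k g))) \<in> A" by (rule memD[OF S(1) jk])
          fix f assume f: "f \<in> ell2 M"
          have T': "T (R' k f) \<in> ell2 I" and S': "S (R' k f) \<in> ell2 I"
            by (intro ops[OF S(1)] bounded_opsD(1)[OF T] R'(2) jk f)+
          have d: "(\<lambda>i. T (R' k f) i - S (R' k f) i) \<in> ell2 I"
            using ell2_add[OF T' ell2_scale[OF S', of "-1"]] by simp
          have "l2_norm (\<lambda>i. R j (T (R' k f)) i - R j (S (R' k f)) i)
              = l2_norm (R j (\<lambda>i. T (R' k f) i - S (R' k f) i))"
            by (simp add: linear_on_diff[OF R'(3)[OF jk(1)] T' S'])
          also have "\<dots> \<le> l2_norm (\<lambda>i. T (R' k f) i - S (R' k f) i)"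
            by (rule R'(5)[OF jk(1) d])
          also have "\<dots> \<le> \<epsilon> * l2_norm (R' k f)"
            by (intro S(2) R'(2) jk f)
          also have "\<dots> \<le> \<epsilon> * l2_norm f"
            using e by (intro mult_left_mono R'(6) jk f) auto
          finally show "l2_norm (\<lambda>i. (\<lambda>g\<in>ell2 M. R j (T (R' k g))) f i - (\<lambda>g\<in>ell2 M. R j (S (R' k g))) f i)
              \<le> \<epsilon> * l2_norm f"
            using f by simp
        qed
      qed
    qed
  qed
qed

section \<open>Substitution operators\<close>

text \<open>The generators of both algebras and the \<open>V\<^sub>t\<close> send each basis vector to zero or to a multiple of a
  basis vector, injectively in the latter case.  Up to weights, such an operator on functions substitutes along the inverse of the map
  on indices, and extends by zero off the image \<open>D\<close>.\<close>

definition pull :: "'i set \<Rightarrow> ('i \<Rightarrow> 'j) \<Rightarrow> ('j \<Rightarrow> complex) \<Rightarrow> ('i \<Rightarrow> complex)" where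
  "pull D \<sigma> f = (\<lambda>i. if i \<in> D then f (\<sigma> i) else 0)"

lemma pull_linear: "linear_on H (pull D \<sigma>)"
  by (auto simp: linear_on_def pull_def)

lemma pull_summable:
  assumes "f \<in> ell2 M" "inj_on \<sigma> D"
  shows "(\<lambda>i. (cmod (pull D \<sigma> f i))\<^sup>2) summable_on UNIV"
    and "(\<Sum>\<^sub>\<infinity>i. (cmod (pull D \<sigma> f i))\<^sup>2) \<le> (\<Sum>\<^sub>\<infinity>i. (cmod (f i))\<^sup>2)"
proof -
  have s: "(\<lambda>i. (cmod (f i))\<^sup>2) summable_on UNIV" using assms by (simp add: ell2_def)
  then have s': "(\<lambda>i. (cmod (f i))\<^sup>2) summable_on \<sigma> ` D"
    by (rule summable_on_subset) auto
  have b: "bij_betw \<sigma> D (\<sigma> ` D)" using assms(2) by (rule inj_on_imp_bij_betw)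
  have "(\<lambda>i. (cmod (f (\<sigma> i)))\<^sup>2) summable_on D"
    using summable_on_reindex_bij_betw[OF b, of "\<lambda>i. (cmod (f i))\<^sup>2"] s' by simp
  then show "(\<lambda>i. (cmod (pull D \<sigma> f i))\<^sup>2) summable_on UNIV"
    by (rule summable_on_cong_neutral[THEN iffD1, rotated 3]) (auto simp: pull_def)
  have "(\<Sum>\<^sub>\<infinity>i. (cmod (pull D \<sigma> f i))\<^sup>2) = (\<Sum>\<^sub>\<infinity>i\<in>D. (cmod (f (\<sigma> i)))\<^sup>2)"
    by (rule infsum_cong_neutral) (auto simp: pull_def)
  also have "\<dots> = (\<Sum>\<^sub>\<infinity>i\<in>\<sigma> ` D. (cmod (f i))\<^sup>2)"
    by (rule infsum_reindex_bij_betw[OF b])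
  also have "\<dots> \<le> (\<Sum>\<^sub>\<infinity>i. (cmod (f i))\<^sup>2)"
    by (rule infsum_mono2[OF s' s]) auto
  finally show "(\<Sum>\<^sub>\<infinity>i. (cmod (pull D \<sigma> f i))\<^sup>2) \<le> (\<Sum>\<^sub>\<infinity>i. (cmod (f i))\<^sup>2)" .
qed

lemma pull_ell2:
  assumes "f \<in> ell2 M" "inj_on \<sigma> D" "D \<subseteq> I"
  shows "pull D \<sigma> f \<in> ell2 I"
  using pull_summable(1)[OF assms(1,2)] assms(3) by (auto simp: ell2_def pull_def)

lemma pull_norm:
  assumes "f \<in> ell2 M" "inj_on \<sigma> D"
  shows "l2_norm (pull D \<sigma> f) \<le> l2_norm f"
  using pull_summable(2)[OF assms] by (simp add: l2_norm_def)

text \<open>The adjoint substitutes along the inverse map: both inner products are the same sum, indexed by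
  \<open>D\<close> and by \<open>D'\<close>.\<close>

lemma pull_adjoint:
  assumes "bij_betw \<sigma> D D'" "\<And>i. i \<in> D \<Longrightarrow> \<rho> (\<sigma> i) = i"
  shows "l2_inner (pull D \<sigma> f) g = l2_inner f (pull D' \<rho> g)"
proof -
  have "l2_inner (pull D \<sigma> f) g = (\<Sum>\<^sub>\<infinity>i\<in>D. f (\<sigma> i) * cnj (g (\<rho> (\<sigma> i))))"
    unfolding l2_inner_def by (rule infsum_cong_neutral) (auto simp: pull_def assms(2))
  also have "\<dots> = (\<Sum>\<^sub>\<infinity>k\<in>D'. f k * cnj (g (\<rho> k)))"
    by (rule infsum_reindex_bij_betw[OF assms(1), of "\<lambda>k. f k * cnj (g (\<rho> k))"])
  also have "\<dots> = l2_inner f (pull D' \<rho> g)"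
    unfolding l2_inner_def by (rule infsum_cong_neutral) (auto simp: pull_def)
  finally show ?thesis .
qed

lemma pull_adjoint_contractions:
  assumes "bij_betw \<sigma> D D'" "\<And>i. i \<in> D \<Longrightarrow> \<rho> (\<sigma> i) = i" "D \<subseteq> I" "D' \<subseteq> M"
  shows "adjoint_contractions (ell2 M) (ell2 I) (pull D \<sigma>) (pull D' \<rho>)"
proof -
  have b: "bij_betw \<rho> D' D" and r: "\<And>k. k \<in> D' \<Longrightarrow> \<sigma> (\<rho> k) = k"
  proof -
    show r: "\<sigma> (\<rho> k) = k" if "k \<in> D'" for k
      using that assms(1,2) unfolding bij_betw_def by auto
    show "bij_betw \<rho> D' D"
      by (rule bij_betw_byWitness[where f' = \<sigma>])
        (use assms r in \<open>auto simp: bij_betw_def\<close>)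
  qed
  show ?thesis
    unfolding adjoint_contractions_def
    using assms b r
    by (auto simp: pull_linear bij_betw_imp_inj_on pull_norm pull_adjoint[OF assms(1,2)]
      pull_adjoint[OF b r] intro!: pull_ell2)
qed

lemma weighted_pull_bounded:
  assumes "inj_on \<sigma> D" "D \<subseteq> I" "\<And>i. i \<in> D \<Longrightarrow> cmod (c i) \<le> C"
  shows "(\<lambda>f\<in>ell2 I. \<lambda>i. c i * pull D \<sigma> f i) \<in> bounded_ops (ell2 I)"
proof -
  let ?T = "\<lambda>f\<in>ell2 I. \<lambda>i. c i * pull D \<sigma> f i"
  have le: "(cmod (c i * pull D \<sigma> f i))\<^sup>2 \<le> C\<^sup>2 * (cmod (pull D \<sigma> f i))\<^sup>2" for f i
  proof (cases "i \<in> D")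
    case True
    then have "(cmod (c i))\<^sup>2 \<le> C\<^sup>2" using assms(3) by (simp add: power_mono)
    then show ?thesis by (simp add: norm_mult power_mult_distrib mult_right_mono)
  qed (simp add: pull_def)
  show ?thesis
  proof (rule bounded_opsI[where C = "\<bar>C\<bar>"])
    fix f assume f: "f \<in> ell2 I"
    have s: "(\<lambda>i. C\<^sup>2 * (cmod (pull D \<sigma> f i))\<^sup>2) summable_on UNIV"
      by (intro summable_on_cmult_right pull_summable[OF f assms(1)])
    have s': "(\<lambda>i. (cmod (c i * pull D \<sigma> f i))\<^sup>2) summable_on UNIV"
      by (rule summable_on_comparison_test[OF s]) (auto intro: le)
    then show "?T f \<in> ell2 I" using f assms(2) by (auto simp: ell2_def pull_def)
    have "(\<Sum>\<^sub>\<infinity>i. (cmod (c i * pull D \<sigma> f i))\<^sup>2) \<le> (\<Sum>\<^sub>\<infinity>i. C\<^sup>2 * (cmod (pull D \<sigma> f i))\<^sup>2)"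
      by (rule infsum_mono[OF s' s]) (rule le)
    also have "\<dots> = C\<^sup>2 * (\<Sum>\<^sub>\<infinity>i. (cmod (pull D \<sigma> f i))\<^sup>2)"
      by (rule infsum_cmult_right')
    also have "\<dots> \<le> C\<^sup>2 * (\<Sum>\<^sub>\<infinity>i. (cmod (f i))\<^sup>2)"
      by (intro mult_left_mono pull_summable[OF f assms(1)]) auto
    finally have "l2_norm (?T f) \<le> sqrt (C\<^sup>2 * (\<Sum>\<^sub>\<infinity>i. (cmod (f i))\<^sup>2))"
      using f by (simp add: l2_norm_def)
    then show "l2_norm (?T f) \<le> \<bar>C\<bar> * l2_norm f"
      by (simp add: l2_norm_def real_sqrt_mult)
  next
    show "linear_on (ell2 I) ?T"
      by (rule linear_onI) (auto simp: ell2_add ell2_scale pull_def algebra_simps)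
  qed auto
qed

lemma pull_bounded:
  assumes "inj_on \<sigma> D" "D \<subseteq> I"
  shows "(\<lambda>f\<in>ell2 I. pull D \<sigma> f) \<in> bounded_ops (ell2 I)"
  using weighted_pull_bounded[OF assms, of "\<lambda>_. 1" 1] by simp

text \<open>In row \<open>u\<close> of the matrix only the column of \<open>\<rho> u\<close> can have a nonzero entry, so that the
  infinite sum has at most one term.\<close>

lemma column_op_eq_pull:
  assumes "bij_betw \<sigma> D D'" "D \<subseteq> I" "\<And>w. w \<in> D \<Longrightarrow> \<rho> (\<sigma> w) = w"
    and "\<And>w. w \<in> D \<Longrightarrow> \<phi> w = (\<lambda>u. c (\<sigma> w) * basis_vec (\<sigma> w) u)"
    and "\<And>w. w \<in> I - D \<Longrightarrow> \<phi> w = (\<lambda>_. 0)"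
  shows "column_op I \<phi> = (\<lambda>f\<in>ell2 I. \<lambda>u. c u * pull D' \<rho> f u)"
  unfolding column_op_def
proof (rule restrict_ext, rule ext)
  fix f u
  show "(\<Sum>\<^sub>\<infinity>w\<in>I. f w * \<phi> w u) = c u * pull D' \<rho> f u"
  proof (cases "u \<in> D'")
    case True
    then obtain w where w: "w \<in> D" "u = \<sigma> w" using assms(1) unfolding bij_betw_def by auto
    have "\<phi> w' u = 0" if "w' \<in> I" "w' \<noteq> w" for w'
      using that w assms unfolding basis_vec_def
      by (cases "w' \<in> D") (auto, metis)
    then have "(\<Sum>\<^sub>\<infinity>w\<in>I. f w * \<phi> w u) = (\<Sum>\<^sub>\<infinity>w\<in>{w}. f w * \<phi> w u)"
      using w assms(2) by (intro infsum_cong_neutral) auto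
    then show ?thesis using True w assms(3,4) by (simp add: pull_def basis_vec_def)
  next
    case False
    have "\<phi> w u = 0" if "w \<in> I" for w
    proof (cases "w \<in> D")
      case True
      then have "\<sigma> w \<noteq> u" using False assms(1) unfolding bij_betw_def by auto
      then show ?thesis using True assms(4) by (auto simp: basis_vec_def)
    qed (use assms(5) that in auto)
    then have "(\<Sum>\<^sub>\<infinity>w\<in>I. f w * \<phi> w u) = 0" by (intro infsum_0) auto
    then show ?thesis using False by (simp add: pull_def)
  qed
qed

section \<open>Composition and factorization of paths\<close>

lemma psrc_pcomp [simp]: "psrc (pcomp v w) = psrc w"
  by (simp add: psrc_def pcomp_def)

lemma plen_pcomp [simp]: "plen (pcomp v w) = plen v + plen w"
  by (simp add: plen_def pcomp_def)

lemma pcomp_assoc: "pcomp (pcomp u v) w = pcomp u (pcomp v w)"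
  by (simp add: pcomp_def)

lemma psrc_vertex_path [simp]: "psrc (vertex_path x) = x"
  by (simp add: psrc_def vertex_path_def)

lemma plen_vertex_path [simp]: "plen (vertex_path x) = 0"
  by (simp add: plen_def vertex_path_def)

lemma prng_vertex_path [simp]: "prng G (vertex_path x) = x"
  by (simp add: prng_def vertex_path_def pre_digraph.awalk_verts_conv)

lemma psrc_edge_path [simp]: "psrc (edge_path G e) = tail G e"
  by (simp add: psrc_def edge_path_def)

lemma plen_edge_path [simp]: "plen (edge_path G e) = 1"
  by (simp add: plen_def edge_path_def)

lemma prng_edge_path [simp]: "prng G (edge_path G e) = head G e"
  by (simp add: prng_def edge_path_def pre_digraph.awalk_verts_conv)

lemma prng_pcomp:
  assumes "psrc v = prng G w"
  shows "prng G (pcomp v w) = prng G v"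
  using assms by (auto simp: prng_def pcomp_def psrc_def pre_digraph.awalk_verts_conv)

lemma pcomp_vertex_path [simp]: "pcomp (vertex_path x) w = w"
  by (simp add: vertex_path_def pcomp_def)

lemma pcomp_vertex_path_right [simp]: "psrc v = x \<Longrightarrow> pcomp v (vertex_path x) = v"
  by (auto simp: vertex_path_def pcomp_def psrc_def)

text \<open>The left inverse of composition with \<open>v\<close> from the left.\<close>

definition path_cut :: "('a, 'b) path \<Rightarrow> ('a, 'b) path \<Rightarrow> ('a, 'b) path" where
  "path_cut v z = (fst z, take (plen z - plen v) (snd z))"

lemma path_cut_pcomp [simp]: "path_cut v (pcomp v w) = w"
  by (simp add: path_cut_def pcomp_def plen_def)

lemma pcomp_left_inject [simp]: "pcomp v w = pcomp v w' \<longleftrightarrow> w = w'"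
  by (metis path_cut_pcomp)

lemma bij_betw_pcomp: "bij_betw (pcomp v) D (pcomp v ` D)"
  by (simp add: inj_on_def inj_on_imp_bij_betw)

lemma bij_betw_path_cut: "bij_betw (path_cut v) (pcomp v ` D) D"
  by (rule bij_betw_byWitness[where f' = "pcomp v"]) auto

context wf_digraph
begin

lemma mem_paths: "w \<in> paths G \<longleftrightarrow> awalk (fst w) (snd w) (prng G w)"
  using paths_iff[of "fst w" "snd w"] by (simp add: prng_def)

lemma psrc_in_verts: "w \<in> paths G \<Longrightarrow> psrc w \<in> verts G"
  by (auto simp: mem_paths psrc_def)

lemma prng_in_verts: "w \<in> paths G \<Longrightarrow> prng G w \<in> verts G"
  by (auto simp: mem_paths)

lemma pcomp_path:
  assumes "v \<in> paths G" "w \<in> paths G" "psrc v = prng G w"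
  shows "pcomp v w \<in> paths G"
  using assms awalk_appendI[of "fst w" "snd w" "fst v" "snd v" "prng G v"]
  by (simp add: mem_paths prng_pcomp) (simp add: pcomp_def psrc_def)

lemma vertex_path_path: "x \<in> verts G \<Longrightarrow> vertex_path x \<in> paths G"
  by (simp add: mem_paths) (simp add: vertex_path_def awalk_Nil_iff)

lemma edge_path_path: "e \<in> arcs G \<Longrightarrow> edge_path G e \<in> paths G"
  by (simp add: mem_paths) (simp add: edge_path_def arc_implies_awalk)

lemma path_split:
  assumes "w \<in> paths G"
  obtains v u where "v \<in> paths G" "u \<in> paths G" "psrc v = prng G u" "w = pcomp v u"
    "snd u = take k (snd w)" "snd v = drop k (snd w)"
proof -
  let ?u = "(fst w, take k (snd w))" and ?v = "(awlast (fst w) (take k (snd w)), drop k (snd w))"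
  have "awalk (fst w) (take k (snd w) @ drop k (snd w)) (prng G w)"
    using assms by (simp add: mem_paths)
  then have "?v \<in> paths G" "?u \<in> paths G"
    unfolding awalk_append_iff by (auto simp: paths_def)
  moreover have "psrc ?v = prng G ?u" "w = pcomp ?v ?u"
    by (simp_all add: psrc_def prng_def pcomp_def)
  ultimately show ?thesis using that by fastforce
qed

end

section \<open>Creation operators and weighted shifts as substitutions\<close>

lemma pull_path_cut_pcomp [simp]:
  "pull (pcomp v ` D) (path_cut v) f (pcomp v w) = (if w \<in> D then f w else 0)"
  by (auto simp: pull_def)

lemma path_cut_vertex_path [simp]: "path_cut (vertex_path x) z = z"
  using path_cut_pcomp[of "vertex_path x" z] by simp

context wf_digraph
begin

lemma creation_op_eq:
  assumes "v \<in> paths G"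
  shows "creation_op G v =
    (\<lambda>f\<in>ell2 (paths G). pull (pcomp v ` {w \<in> paths G. psrc v = prng G w}) (path_cut v) f)"
  unfolding creation_op_def
  by (subst column_op_eq_pull[where \<sigma> = "pcomp v" and \<rho> = "path_cut v" and c = "\<lambda>_. 1"
        and D = "{w \<in> paths G. psrc v = prng G w}"])
    (auto intro!: bij_betw_pcomp)

lemma shift_op_eq:
  "shift_op G lam e =
    (\<lambda>f\<in>ell2 (paths G). \<lambda>u. lam u *
      pull (pcomp (edge_path G e) ` {w \<in> paths G. tail G e = prng G w}) (path_cut (edge_path G e)) f u)"
  unfolding shift_op_def
  by (subst column_op_eq_pull[where \<sigma> = "pcomp (edge_path G e)" and \<rho> = "path_cut (edge_path G e)"
        and c = lam and D = "{w \<in> paths G. tail G e = prng G w}"])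
    (auto intro!: bij_betw_pcomp)

lemma creation_op_bounded:
  assumes "v \<in> paths G"
  shows "creation_op G v \<in> bounded_ops (ell2 (paths G))"
  unfolding creation_op_eq[OF assms]
  by (rule pull_bounded[OF bij_betw_imp_inj_on[OF bij_betw_path_cut]])
    (use assms in \<open>auto intro: pcomp_path\<close>)

lemma cstar_toeplitz_algebra: "cstar_subalgebra (ell2 (paths G)) (toeplitz_algebra G)"
  unfolding toeplitz_algebra_def path_space_def
  by (rule cstar_generated_subalgebra) (auto intro: creation_op_bounded)

lemma vertex_proj_apply:
  assumes "x \<in> verts G" "f \<in> ell2 (paths G)"
  shows "vertex_proj G x f p = (if p \<in> paths G \<and> prng G p = x then f p else 0)"
proof -
  have "pcomp (vertex_path x) ` {w \<in> paths G. x = prng G w} = {w \<in> paths G. x = prng G w}"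
    by simp
  then show ?thesis
    using assms by (auto simp: vertex_proj_def creation_op_eq[OF vertex_path_path] pull_def)
qed

end

section \<open>Factorization into short paths and paths of the power graph\<close>

locale power_graph_setting = fin_digraph E for E :: "('a, 'b) pre_digraph" +
  fixes n :: nat
  assumes n_pos: "n \<ge> 1"
begin

abbreviation F :: "('a, ('a, 'b) path \<times> 'a) pre_digraph" where
  "F \<equiv> power_graph E n"

abbreviation P :: "('a, 'b) path set" where
  "P \<equiv> {q \<in> paths E. n dvd plen q}"

text \<open>The length of \<open>q\<close> is the largest multiple of \<open>n\<close> that does not exceed the length of the product, and this is where
  the remainder is cut off.\<close>

lemma path_rem_pcomp_lt:
  assumes s: "s \<in> paths_lt E n" and q: "q \<in> P" and sq: "psrc s = prng E q"
  shows "path_rem E n (pcomp s q) = s"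
proof -
  have "s \<in> paths E" "plen s < n" using s by (auto simp: paths_lt_def)
  have len: "length (snd q @ snd s) - length (snd q @ snd s) mod n = length (snd q)"
    using \<open>plen s < n\<close> q by (auto simp: plen_def dvd_def)
  have "\<exists>!t. factor_end E n (pcomp s q) t"
    using q by (intro factor_end_ex1[OF n_pos] pcomp_path sq \<open>s \<in> paths E\<close>) auto
  then have "factor_end E n (pcomp s q) (path_rem E n (pcomp s q))"
    unfolding path_rem_def by (rule theI')
  from factor_end_unique[OF this] show ?thesis
    unfolding pcomp_def fst_conv snd_conv len using sq
    by (simp add: psrc_def prng_def prod_eq_iff)
qed

lemma path_decompose:
  assumes "w \<in> paths E"
  obtains s q where "s \<in> paths_lt E n" "q \<in> P" "psrc s = prng E q" "w = pcomp s q"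
proof -
  obtain s q where sq: "s \<in> paths E" "q \<in> paths E" "psrc s = prng E q" "w = pcomp s q"
    "snd q = take (plen w - plen w mod n) (snd w)" "snd s = drop (plen w - plen w mod n) (snd w)"
    by (rule path_split[OF assms])
  have "plen q = plen w - plen w mod n" "plen s = plen w mod n"
    using sq(5,6) by (auto simp: plen_def)
  then have "q \<in> P" "s \<in> paths_lt E n"
    using sq(1,2) n_pos by (simp_all add: paths_lt_def dvd_minus_mod)
  then show ?thesis using sq that by blast
qed

lemma path_rem_props:
  assumes "w \<in> paths E"
  shows "path_rem E n w \<in> paths_lt E n" "prng E (path_rem E n w) = prng E w"
proof -
  obtain s q where sq: "s \<in> paths_lt E n" "q \<in> P" "psrc s = prng E q" "w = pcomp s q"
    by (rule path_decompose[OF assms])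
  then show "path_rem E n w \<in> paths_lt E n" "prng E (path_rem E n w) = prng E w"
    by (simp_all add: path_rem_pcomp_lt prng_pcomp)
qed

lemma P_pcomp:
  assumes "p \<in> P" "q \<in> P" "psrc p = prng E q"
  shows "pcomp p q \<in> P"
  using assms by (auto intro: pcomp_path)

text \<open>Removing blocks of length \<open>n\<close> at the start does not change the remainder.  For weights of period
  \<open>n\<close> this gives \<open>\<lambda>(euq) = \<lambda>(eu)\<close>.\<close>

lemma path_rem_pcomp:
  assumes u: "u \<in> paths E" and q: "q \<in> P" and uq: "psrc u = prng E q"
  shows "path_rem E n (pcomp u q) = path_rem E n u"
proof -
  obtain s p where sp: "s \<in> paths_lt E n" "p \<in> P" "psrc s = prng E p" "u = pcomp s p"
    by (rule path_decompose[OF u])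
  have "psrc p = prng E q" using uq sp by simp
  then show ?thesis
    using sp q P_pcomp[of p q] by (simp add: pcomp_assoc path_rem_pcomp_lt prng_pcomp)
qed

lemma path_rem_short: "s \<in> paths_lt E n \<Longrightarrow> path_rem E n s = s"
  using path_rem_pcomp_lt[of s "vertex_path (psrc s)"]
  by (auto simp: paths_lt_def intro: vertex_path_path psrc_in_verts)

section \<open>Paths in the power graph\<close>

text \<open>The path \<open>v\<^sub>k \<dots> v\<^sub>1\<close> of \<open>E\<close> that belongs to a path of the power graph with edges \<open>v\<^sub>1, \<dots>, v\<^sub>k\<close>.\<close>

definition flatten :: "('a, ('a, 'b) path \<times> 'a) path \<Rightarrow> ('a, 'b) path" where
  "flatten p = (fst p, concat (map (snd \<circ> fst) (snd p)))"

lemma wf_power_graph: "wf_digraph F"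
  by unfold_locales (auto simp: power_graph_def paths_eq_def intro: prng_in_verts)

sublocale F: wf_digraph F
  by (rule wf_power_graph)

lemma psrc_flatten [simp]: "psrc (flatten p) = psrc p"
  by (simp add: flatten_def psrc_def)

lemma flatten_pcomp: "flatten (pcomp p q) = pcomp (flatten p) (flatten q)"
  by (simp add: flatten_def pcomp_def)

lemma verts_F [simp]: "verts F = verts E"
  by (simp add: power_graph_def)

lemma F_arcD:
  assumes "a \<in> arcs F"
  obtains v where "v \<in> paths_eq E n" "a = (v, psrc v)" "tail F a = psrc v" "head F a = prng E v"
  using assms by (auto simp: power_graph_def)

lemma F_arcI:
  assumes "v \<in> paths_eq E n"
  shows "(v, psrc v) \<in> arcs F" "tail F (v, psrc v) = psrc v" "head F (v, psrc v) = prng E v"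
  using assms psrc_in_verts[of v] by (auto simp: power_graph_def paths_eq_def)

lemma flatten_edge_path:
  assumes "v \<in> paths_eq E n"
  shows "flatten (edge_path F (v, psrc v)) = v"
  using F_arcI(2)[OF assms] by (simp add: flatten_def edge_path_def psrc_def)

text \<open>Induction from the end of the path: a new first edge is put before \<open>p\<close>.\<close>

lemma F_path_induct [consumes 1, case_names vertex edge]:
  assumes "p \<in> paths F"
    and "\<And>x. x \<in> verts E \<Longrightarrow> Q (vertex_path x)"
    and "\<And>p v. p \<in> paths F \<Longrightarrow> v \<in> paths_eq E n \<Longrightarrow> psrc p = prng E v \<Longrightarrow> Q p \<Longrightarrow>
      Q (pcomp p (edge_path F (v, psrc v)))"
  shows "Q p"
proof -
  have "(x, l) \<in> paths F \<Longrightarrow> Q (x, l)" for x l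
  proof (induction l arbitrary: x)
    case Nil
    then show ?case
      using assms(2)[of x] by (simp add: F.mem_paths F.awalk_Nil_iff vertex_path_def)
  next
    case (Cons a l)
    from Cons.prems have a: "a \<in> arcs F" "x = tail F a" and l: "(head F a, l) \<in> paths F"
      by (auto simp: paths_def F.awalk_Cons_iff)
    obtain v where v: "v \<in> paths_eq E n" "a = (v, psrc v)" "tail F a = psrc v" "head F a = prng E v"
      by (rule F_arcD[OF a(1)])
    have "Q (pcomp (head F a, l) (edge_path F (v, psrc v)))"
      by (rule assms(3)[OF l v(1) _ Cons.IH[OF l]]) (use v in \<open>simp add: psrc_def\<close>)
    then show ?case using v a by (simp add: pcomp_def edge_path_def)
  qed
  then show ?thesis using assms(1) by (metis prod.collapse)
qed

lemma flatten_vertex_path [simp]: "flatten (vertex_path x) = vertex_path x"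
  by (simp add: flatten_def vertex_path_def)

lemma flatten_path:
  assumes "p \<in> paths F"
  shows "flatten p \<in> P \<and> prng E (flatten p) = prng F p \<and> plen (flatten p) = n * plen p"
  using assms
proof (induction rule: F_path_induct)
  case (vertex x)
  then show ?case by (simp add: vertex_path_path)
next
  case (edge p v)
  have a: "edge_path F (v, psrc v) \<in> paths F" "prng F (edge_path F (v, psrc v)) = psrc p"
    "psrc (edge_path F (v, psrc v)) = psrc v"
    using edge.hyps by (auto intro: F.edge_path_path F_arcI simp: F_arcI)
  have v: "v \<in> P" "plen v = n" using edge.hyps by (auto simp: paths_eq_def)
  show ?case
    using edge v a P_pcomp[of "flatten p" v]
    by (simp add: flatten_pcomp flatten_edge_path prng_pcomp)
qed

text \<open>An edge of the power graph records its source twice.  Along a path the sources are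
  determined by the starting vertex, so the lists of edges in \<open>E\<close> suffice to recover the path.\<close>

lemma F_arc_data_inject:
  assumes "(x, l) \<in> paths F" "(x, l') \<in> paths F" "map (snd \<circ> fst) l = map (snd \<circ> fst) l'"
  shows "l = l'"
proof -
  have "length l = length l'" using assms(3) by (rule map_eq_imp_length_eq)
  then show ?thesis
    using assms
  proof (induction l l' arbitrary: x rule: list_induct2)
    case (Cons a l b l')
    from Cons.prems have a: "a \<in> arcs F" "x = tail F a" "(head F a, l) \<in> paths F"
      and b: "b \<in> arcs F" "x = tail F b" "(head F b, l') \<in> paths F"
      by (auto simp: paths_def F.awalk_Cons_iff)
    obtain v where v: "a = (v, psrc v)" "tail F a = psrc v" by (rule F_arcD[OF a(1)])
    obtain w where w: "b = (w, psrc w)" "tail F b = psrc w" by (rule F_arcD[OF b(1)])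
    have "v = w" using v w a(2) b(2) Cons.prems(3) by (simp add: psrc_def prod_eq_iff)
    then have "a = b" using v w by simp
    then show ?case using Cons.IH[OF a(3)] b(3) Cons.prems(3) by simp
  qed simp
qed

text \<open>Since all blocks have the same length \<open>n\<close>, the concatenation determines the blocks.\<close>

lemma flatten_inj: "inj_on flatten (paths F)"
proof (rule inj_onI)
  fix p q assume p: "p \<in> paths F" and q: "q \<in> paths F" and eq: "flatten p = flatten q"
  have "n * plen p = n * plen q" using flatten_path[OF p] flatten_path[OF q] eq by metis
  then have len: "length (snd p) = length (snd q)" using n_pos by (simp add: plen_def)
  have arc_len: "length (snd (fst a)) = n" if "r \<in> paths F" "a \<in> set (snd r)" for r a
  proof -
    have "a \<in> arcs F" using that unfolding F.mem_paths by (auto simp: F.awalk_def)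
    then show ?thesis by (auto elim!: F_arcD simp: paths_eq_def plen_def)
  qed
  define xs ys where "xs = map (snd \<circ> fst) (snd p)" and "ys = map (snd \<circ> fst) (snd q)"
  have lx: "length x = n" if "x \<in> set xs" for x
    using that arc_len[OF p] by (auto simp: xs_def)
  have ly: "length y = n" if "y \<in> set ys" for y
    using that arc_len[OF q] by (auto simp: ys_def)
  have "length x = length y" if "(x, y) \<in> set (zip xs ys)" for x y
    using lx[OF set_zip_leftD[OF that]] ly[OF set_zip_rightD[OF that]] by simp
  then have "\<forall>(x, y)\<in>set (zip xs ys). length x = length y" by blast
  moreover have "concat xs = concat ys" "length xs = length ys"
    using eq len by (simp_all add: flatten_def xs_def ys_def)
  ultimately have "map (snd \<circ> fst) (snd p) = map (snd \<circ> fst) (snd q)"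
    using concat_injective unfolding xs_def ys_def by blast
  moreover have "fst p = fst q" using eq by (simp add: flatten_def)
  ultimately show "p = q"
    using F_arc_data_inject[of "fst p" "snd p" "snd q"] p q by (metis prod.collapse)
qed

lemma flatten_surj:
  assumes "q \<in> P"
  obtains p where "p \<in> paths F" "flatten p = q"
proof -
  have "\<exists>p\<in>paths F. flatten p = q" if "q \<in> paths E" "plen q = n * k" for k q
    using that
  proof (induction k arbitrary: q)
    case 0
    then have "q = vertex_path (psrc q)" by (simp add: plen_def psrc_def vertex_path_def prod_eq_iff)
    then show ?case
      using psrc_in_verts[OF 0(1)] F.vertex_path_path by (metis flatten_vertex_path verts_F)
  next
    case (Suc k)
    obtain v u where vu: "v \<in> paths E" "u \<in> paths E" "psrc v = prng E u" "q = pcomp v u"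
      "snd u = take n (snd q)" "snd v = drop n (snd q)"
      by (rule path_split[OF Suc.prems(1)])
    have u: "u \<in> paths_eq E n" and "plen v = n * k"
      using vu Suc.prems(2) by (auto simp: paths_eq_def plen_def)
    then obtain p where p: "p \<in> paths F" "flatten p = v" using Suc.IH vu(1) by blast
    have "psrc p = psrc v" using p psrc_flatten by metis
    then have "pcomp p (edge_path F (u, psrc u)) \<in> paths F"
      using p(1) u vu(3) by (intro F.pcomp_path F.edge_path_path F_arcI) (auto simp: F_arcI)
    moreover have "flatten (pcomp p (edge_path F (u, psrc u))) = q"
      using u p vu by (simp add: flatten_pcomp flatten_edge_path)
    ultimately show ?case by blast
  qed
  then show ?thesis using assms that unfolding dvd_def by blast
qed

text \<open>The factorization \<open>w = t p\<close> behind the decomposition of the path space; it is unique by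
  \<open>pcomp_flatten_inject\<close>.\<close>

lemma path_cases:
  assumes "w \<in> paths E"
  obtains s p where "s \<in> paths_lt E n" "p \<in> paths F" "psrc s = prng F p" "w = pcomp s (flatten p)"
proof -
  obtain s q where sq: "s \<in> paths_lt E n" "q \<in> P" "psrc s = prng E q" "w = pcomp s q"
    by (rule path_decompose[OF assms])
  obtain p where "p \<in> paths F" "flatten p = q" by (rule flatten_surj[OF sq(2)])
  then show ?thesis using sq flatten_path[of p] that by auto
qed

lemma pcomp_flatten_path:
  assumes "s \<in> paths E" "p \<in> paths F" "psrc s = prng F p"
  shows "pcomp s (flatten p) \<in> paths E"
  using assms flatten_path[of p] by (auto intro: pcomp_path)

lemma path_rem_pcomp_flatten:
  assumes "s \<in> paths_lt E n" "p \<in> paths F" "psrc s = prng F p"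
  shows "path_rem E n (pcomp s (flatten p)) = s"
  using assms flatten_path[of p] by (auto intro: path_rem_pcomp_lt)

lemma pcomp_flatten_inject:
  assumes "s \<in> paths_lt E n" "p \<in> paths F" "psrc s = prng F p"
    and "t \<in> paths_lt E n" "q \<in> paths F" "psrc t = prng F q"
  shows "pcomp s (flatten p) = pcomp t (flatten q) \<longleftrightarrow> s = t \<and> p = q"
proof
  assume eq: "pcomp s (flatten p) = pcomp t (flatten q)"
  then have "s = t" using path_rem_pcomp_flatten assms by metis
  then show "s = t \<and> p = q"
    using eq flatten_inj assms(2,5) by (auto dest: inj_onD)
qed auto

section \<open>Boundedness and periodicity of the generators\<close>

lemma has_period_rem:
  assumes "has_period E n lam" "e \<in> arcs E" "w \<in> paths E" "tail E e = prng E w"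
  shows "lam (pcomp (edge_path E e) w) = lam (pcomp (edge_path E e) (path_rem E n w))"
proof -
  note r = path_rem_props[OF assms(3)]
  have "path_rem E n (path_rem E n w) = path_rem E n w"
    using r(1) by (rule path_rem_short)
  moreover have "path_rem E n w \<in> paths E" using r(1) by (simp add: paths_lt_def)
  ultimately show ?thesis
    using assms r(2) unfolding has_period_def by metis
qed

text \<open>A periodic weight takes only finitely many values on the paths \<open>ew\<close>, at most one for each short path.\<close>

lemma shift_op_bounded:
  assumes "has_period E n lam" "e \<in> arcs E"
  shows "shift_op E lam e \<in> bounded_ops (ell2 (paths E))"
  unfolding shift_op_eq
proof (rule weighted_pull_bounded)
  let ?D = "{w \<in> paths E. tail E e = prng E w}"
  let ?C = "\<Sum>t\<in>paths_lt E n. cmod (lam (pcomp (edge_path E e) t))"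
  show "inj_on (path_cut (edge_path E e)) (pcomp (edge_path E e) ` ?D)"
    using bij_betw_path_cut by (rule bij_betw_imp_inj_on)
  show "pcomp (edge_path E e) ` ?D \<subseteq> paths E"
    using assms(2) by (auto intro!: pcomp_path edge_path_path)
  fix z assume "z \<in> pcomp (edge_path E e) ` ?D"
  then obtain w where w: "w \<in> paths E" "tail E e = prng E w" "z = pcomp (edge_path E e) w" by auto
  show "cmod (lam z) \<le> ?C"
    unfolding w(3) has_period_rem[OF assms w(1,2)]
    by (rule member_le_sum[where f = "\<lambda>t. cmod (lam (pcomp (edge_path E e) t))"])
      (auto intro: path_rem_props(1)[OF w(1)] finite_paths_lt)
qed

lemma cstar_periodic_shift_algebra:
  "cstar_subalgebra (ell2 (paths E)) (periodic_shift_algebra E n)"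
  unfolding periodic_shift_algebra_def path_space_def
  by (rule cstar_generated_subalgebra) (auto intro: shift_op_bounded)

lemma shift_op_mem:
  assumes "has_period E n lam" "e \<in> arcs E"
  shows "shift_op E lam e \<in> periodic_shift_algebra E n"
  using cstar_generated_superset assms unfolding periodic_shift_algebra_def by fast

text \<open>With this weight the component at \<open>e\<close> is the elementary shift \<open>T\<^bsub>(e,t)\<^esub>\<close>: the last edge of \<open>z = ew\<close> is
  removed and the remainder of \<open>w\<close> compared with \<open>t\<close>.\<close>

definition elementary_weight :: "('a, 'b) path \<Rightarrow> ('a, 'b) path \<Rightarrow> complex" where
  "elementary_weight t z = (if path_rem E n (fst z, butlast (snd z)) = t then 1 else 0)"

lemma elementary_weight_edge:
  "elementary_weight t (pcomp (edge_path E e) w) = (if path_rem E n w = t then 1 else 0)"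
  by (simp add: elementary_weight_def pcomp_def edge_path_def)

lemma has_period_elementary_weight: "has_period E n (elementary_weight t)"
  by (simp add: has_period_def elementary_weight_edge)

section \<open>Prefixing operators\<close>

text \<open>The operator \<open>W\<^sub>u\<close> with \<open>W\<^sub>u \<xi>\<^sub>q = \<xi>\<^bsub>uq\<^esub>\<close> if \<open>uq\<close> is a path and the length of \<open>q\<close> is divisible by \<open>n\<close>,
  and \<open>W\<^sub>u \<xi>\<^sub>q = 0\<close> otherwise.\<close>

definition prefix_op where
  "prefix_op u = (\<lambda>f\<in>ell2 (paths E).
    pull (pcomp u ` {q \<in> P. psrc u = prng E q}) (path_cut u) f)"

definition unprefix_op where
  "unprefix_op u = (\<lambda>f\<in>ell2 (paths E). pull {q \<in> P. psrc u = prng E q} (pcomp u) f)"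

lemma prefix_image_subset:
  assumes "u \<in> paths E"
  shows "pcomp u ` {q \<in> P. psrc u = prng E q} \<subseteq> paths E"
  using assms by (auto intro: pcomp_path)

lemma unprefix_op_bounded: "unprefix_op u \<in> bounded_ops (ell2 (paths E))"
  unfolding unprefix_op_def by (rule pull_bounded) (auto simp: inj_on_def)

lemma prefix_op_adjoint: "is_adjoint (ell2 (paths E)) (prefix_op u) (unprefix_op u)"
  unfolding is_adjoint_def prefix_op_def unprefix_op_def
  by (auto intro!: pull_adjoint bij_betw_path_cut)

text \<open>All vectors \<open>\<xi>\<^bsub>uq\<^esub>\<close> in the range of \<open>W\<^sub>u\<close> have the same remainder \<open>u(n)\<close>, so one elementary shift
  prepends \<open>e\<close> to all of them.\<close>

lemma prefix_op_step:
  assumes e: "e \<in> arcs E" and u: "u \<in> paths E" and eu: "tail E e = prng E u"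
  shows "compose (ell2 (paths E)) (shift_op E (elementary_weight (path_rem E n u)) e) (prefix_op u)
    = prefix_op (pcomp (edge_path E e) u)"
  unfolding compose_def prefix_op_def shift_op_eq
proof (rule restrict_ext, rule ext)
  fix f z assume f: "f \<in> ell2 (paths E)"
  let ?D = "{q \<in> P. psrc u = prng E q}" and ?e = "edge_path E e"
  let ?W = "pull (pcomp u ` ?D) (path_cut u) f"
  let ?S = "\<lambda>z. elementary_weight (path_rem E n u) z *
    pull (pcomp ?e ` {w \<in> paths E. tail E e = prng E w}) (path_cut ?e) ?W z"
  have W: "?W \<in> ell2 (paths E)"
    by (rule pull_ell2[OF f bij_betw_imp_inj_on[OF bij_betw_path_cut] prefix_image_subset[OF u]])
  have "?S z = pull (pcomp (pcomp ?e u) ` ?D) (path_cut (pcomp ?e u)) f z"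
  proof (cases "\<exists>q\<in>?D. z = pcomp (pcomp ?e u) q")
    case True
    then obtain q where q: "q \<in> ?D" "z = pcomp (pcomp ?e u) q" by auto
    then have "pcomp u q \<in> paths E" "prng E (pcomp u q) = prng E u"
      "path_rem E n (pcomp u q) = path_rem E n u"
      using u by (auto intro: pcomp_path path_rem_pcomp simp: prng_pcomp)
    then have "?S (pcomp ?e (pcomp u q)) = f q"
      using q(1) eu by (simp add: elementary_weight_edge)
    moreover have "pull (pcomp (pcomp ?e u) ` ?D) (path_cut (pcomp ?e u)) f z = f q"
      unfolding q(2) pull_path_cut_pcomp using q(1) by simp
    ultimately show ?thesis unfolding q(2) pcomp_assoc by simp
  next
    case False
    have "?S z = 0"
    proof (cases "\<exists>w\<in>paths E. z = pcomp ?e w")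
      case True
      then obtain w where w: "z = pcomp ?e w" by auto
      then have "w \<notin> pcomp u ` ?D" using False by (auto simp: pcomp_assoc)
      then have "?W w = 0" by (simp add: pull_def)
      then show ?thesis using w by simp
    qed (auto simp: pull_def)
    then show ?thesis using False by (auto simp: pull_def)
  qed
  then show "(\<lambda>f\<in>ell2 (paths E). \<lambda>z. elementary_weight (path_rem E n u) z *
      pull (pcomp ?e ` {w \<in> paths E. tail E e = prng E w}) (path_cut ?e) f z)
      ((\<lambda>f\<in>ell2 (paths E). pull (pcomp u ` ?D) (path_cut u) f) f) z
    = pull (pcomp (pcomp ?e u) ` {q \<in> P. psrc (pcomp ?e u) = prng E q}) (path_cut (pcomp ?e u)) f z"
    using f W by simp
qed

text \<open>The paths with range \<open>x\<close> whose length is divisible by \<open>n\<close> are exactly those with remainder the vertex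
  \<open>x\<close>.\<close>

lemma prefix_op_edge:
  assumes e: "e \<in> arcs E"
  shows "prefix_op (edge_path E e) = shift_op E (elementary_weight (vertex_path (tail E e))) e"
  unfolding prefix_op_def shift_op_eq
proof (rule restrict_ext, rule ext)
  fix f z
  let ?e = "edge_path E e" and ?x = "vertex_path (tail E e)"
  have x: "?x \<in> paths_lt E n" using e n_pos by (simp add: paths_lt_def vertex_path_path)
  have iff: "path_rem E n w = ?x \<longleftrightarrow> w \<in> P" if w: "w \<in> paths E" "tail E e = prng E w" for w
  proof
    assume r: "path_rem E n w = ?x"
    obtain s q where sq: "s \<in> paths_lt E n" "q \<in> P" "psrc s = prng E q" "w = pcomp s q"
      by (rule path_decompose[OF w(1)])
    then have "s = ?x" using r by (simp add: path_rem_pcomp_lt)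
    then show "w \<in> P" using sq by simp
  next
    assume "w \<in> P"
    then show "path_rem E n w = ?x" using path_rem_pcomp_lt[OF x, of w] w(2) by simp
  qed
  show "pull (pcomp ?e ` {q \<in> P. psrc ?e = prng E q}) (path_cut ?e) f z
    = elementary_weight ?x z * pull (pcomp ?e ` {w \<in> paths E. tail E e = prng E w}) (path_cut ?e) f z"
  proof (cases "\<exists>w. z = pcomp ?e w")
    case True
    then obtain w where "z = pcomp ?e w" by auto
    then show ?thesis using iff[of w] by (auto simp: elementary_weight_edge)
  qed (auto simp: pull_def)
qed

lemma prefix_op_vertex:
  assumes e: "e \<in> arcs E"
  shows "compose (ell2 (paths E)) (unprefix_op (edge_path E e)) (prefix_op (edge_path E e))
    = prefix_op (vertex_path (tail E e))"
proof -
  let ?H = "ell2 (paths E)" and ?e = "edge_path E e"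
  have "unprefix_op ?e (prefix_op ?e f) = pull {q \<in> P. tail E e = prng E q} (\<lambda>q. q) f"
    if f: "f \<in> ?H" for f
  proof -
    have "pull (pcomp ?e ` {q \<in> P. tail E e = prng E q}) (path_cut ?e) f \<in> ?H"
      by (rule pull_ell2[OF f bij_betw_imp_inj_on[OF bij_betw_path_cut]])
        (use prefix_image_subset[OF edge_path_path[OF e]] in simp)
    then show ?thesis using f by (auto simp: prefix_op_def unprefix_op_def pull_def)
  qed
  moreover have "prefix_op (vertex_path (tail E e)) f = pull {q \<in> P. tail E e = prng E q} (\<lambda>q. q) f"
    if f: "f \<in> ?H" for f
    using f by (simp add: prefix_op_def pull_def cong: if_cong)
  ultimately show ?thesis
    by (intro ext) (simp add: compose_def prefix_op_def restrict_def)
qed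

text \<open>By induction on the length of \<open>u\<close>.  The step prepends an edge by an elementary shift; a vertex is
  obtained from an edge \<open>e\<close> leaving it, as the initial projection \<open>W\<^sub>e\<^sup>* W\<^sub>e\<close>.\<close>

lemma prefix_op_mem:
  assumes no_sinks: "\<forall>x\<in>verts E. \<exists>e\<in>arcs E. tail E e = x" and u: "u \<in> paths E"
  shows "prefix_op u \<in> periodic_shift_algebra E n"
proof -
  note cs = cstar_subalgebraD[OF cstar_periodic_shift_algebra]
  have "(x, l) \<in> paths E \<Longrightarrow> prefix_op (x, l) \<in> periodic_shift_algebra E n" for x l
  proof (induction l rule: rev_induct)
    case Nil
    then have "x \<in> verts E" using psrc_in_verts by (fastforce simp: psrc_def)
    then obtain e where e: "e \<in> arcs E" "tail E e = x" using no_sinks by blast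
    have m: "prefix_op (edge_path E e) \<in> periodic_shift_algebra E n"
      unfolding prefix_op_edge[OF e(1)]
      by (rule shift_op_mem[OF has_period_elementary_weight e(1)])
    have "unprefix_op (edge_path E e) \<in> periodic_shift_algebra E n"
      by (rule cs(6)[OF m unprefix_op_bounded prefix_op_adjoint])
    from cs(5)[OF this m] show ?case
      unfolding prefix_op_vertex[OF e(1)] e(2) by (simp add: vertex_path_def)
  next
    case (snoc e l)
    have a: "awalk x (l @ [e]) (prng E (x, l @ [e]))" using snoc.prems by (simp add: mem_paths)
    then have l: "(x, l) \<in> paths E" and e: "e \<in> arcs E" "tail E e = prng E (x, l)"
      unfolding awalk_append_iff by (auto simp: paths_def awalk_Cons_iff prng_def)
    have "(x, l @ [e]) = pcomp (edge_path E e) (x, l)" by (simp add: pcomp_def edge_path_def)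
    then show ?case
      using cs(5)[OF shift_op_mem[OF has_period_elementary_weight e(1)] snoc.IH[OF l],
          of "path_rem E n (x, l)"]
      unfolding prefix_op_step[OF e(1) l e(2)] by simp
  qed
  then show ?thesis using u by (metis prod.collapse)
qed

section \<open>The components of the path space\<close>

text \<open>The paths \<open>p\<close> for which \<open>tp\<close> is a path; they index an orthonormal basis of \<open>P\<^bsub>s(t)\<^esub> \<H>\<^sub>F\<close>.\<close>

definition slot where
  "slot t = {p \<in> paths F. psrc t = prng F p}"

definition glue where
  "glue t p = pcomp t (flatten p)"

text \<open>The partial isometry \<open>V\<^sub>t\<close>, with \<open>V\<^sub>t \<xi>\<^sub>p = \<xi>\<^bsub>tp\<^esub>\<close> for \<open>p\<close> in the slot of \<open>t\<close> and zero on the other basis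
  vectors.\<close>

definition from_component ::
  "('a, 'b) path \<Rightarrow> (('a, ('a, 'b) path \<times> 'a) path \<Rightarrow> complex) \<Rightarrow> (('a, 'b) path \<Rightarrow> complex)" where
  "from_component t = pull (glue t ` slot t) (inv_into (slot t) (glue t))"

text \<open>The adjoint \<open>V\<^sub>t\<^sup>*\<close>, which extracts the coefficients of the basis vectors \<open>\<xi>\<^bsub>tp\<^esub>\<close>.\<close>

definition component ::
  "('a, 'b) path \<Rightarrow> (('a, 'b) path \<Rightarrow> complex) \<Rightarrow> (('a, ('a, 'b) path \<times> 'a) path \<Rightarrow> complex)" where
  "component t = pull (slot t) (glue t)"

abbreviation HE :: "(('a, 'b) path \<Rightarrow> complex) set" where
  "HE \<equiv> ell2 (paths E)"

abbreviation HF :: "(('a, ('a, 'b) path \<times> 'a) path \<Rightarrow> complex) set" where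
  "HF \<equiv> ell2 (paths F)"

lemma ltD: "t \<in> paths_lt E n \<Longrightarrow> t \<in> paths E"
  by (simp add: paths_lt_def)

lemma glue_inject:
  assumes "s \<in> paths_lt E n" "p \<in> slot s" "t \<in> paths_lt E n" "q \<in> slot t"
  shows "glue s p = glue t q \<longleftrightarrow> s = t \<and> p = q"
  using pcomp_flatten_inject assms unfolding glue_def slot_def by simp

lemma glue_path: "t \<in> paths E \<Longrightarrow> p \<in> slot t \<Longrightarrow> glue t p \<in> paths E"
  by (simp add: glue_def slot_def pcomp_flatten_path)

lemma glue_cases:
  assumes "w \<in> paths E"
  obtains s p where "s \<in> paths_lt E n" "p \<in> slot s" "w = glue s p"
  using path_cases[OF assms] unfolding glue_def slot_def by blast

lemma glue_inj: "inj_on (glue t) (slot t)"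
  using flatten_inj by (auto simp: glue_def slot_def inj_on_def)

lemma from_component_glue:
  assumes "s \<in> paths_lt E n" "p \<in> slot s" "t \<in> paths_lt E n"
  shows "from_component t f (glue s p) = (if s = t then f p else 0)"
  using assms glue_inj[of t] by (auto simp: from_component_def pull_def glue_inject)

lemma from_component_outside:
  assumes "t \<in> paths_lt E n" "w \<notin> paths E"
  shows "from_component t f w = 0"
  using assms(2) glue_path[OF ltD[OF assms(1)]] by (auto simp: from_component_def pull_def)

lemma component_apply: "component t f p = (if p \<in> slot t then f (glue t p) else 0)"
  by (simp add: component_def pull_def)

text \<open>That is, \<open>V\<^sub>s\<^sup>* V\<^sub>t = 0\<close> for \<open>s \<noteq> t\<close>, while \<open>V\<^sub>t\<^sup>* V\<^sub>t\<close> is the vertex projection of the source of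
  \<open>t\<close>.\<close>

lemma component_from_component:
  assumes "s \<in> paths_lt E n" "t \<in> paths_lt E n"
  shows "component s (from_component t f) p = (if s = t \<and> p \<in> slot t then f p else 0)"
  using assms by (auto simp: component_apply from_component_glue)

lemma component_adjoint:
  assumes "t \<in> paths_lt E n"
  shows "adjoint_contractions HE HF (component t) (from_component t)"
  unfolding component_def from_component_def
proof (rule pull_adjoint_contractions)
  show "bij_betw (glue t) (slot t) (glue t ` slot t)"
    by (rule inj_on_imp_bij_betw[OF glue_inj])
  show "inv_into (slot t) (glue t) (glue t p) = p" if "p \<in> slot t" for p
    using that glue_inj by simp
  show "slot t \<subseteq> paths F" by (auto simp: slot_def)
  show "glue t ` slot t \<subseteq> paths E" using glue_path[OF ltD[OF assms]] by blast
qed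

lemmas from_component_adjoint = adjoint_contractions_sym[OF component_adjoint]

lemma component_in: "t \<in> paths_lt E n \<Longrightarrow> f \<in> HE \<Longrightarrow> component t f \<in> HF"
  using adjoint_contractionsD(1)[OF component_adjoint] .

lemma from_component_in: "t \<in> paths_lt E n \<Longrightarrow> g \<in> HF \<Longrightarrow> from_component t g \<in> HE"
  using adjoint_contractionsD(2)[OF component_adjoint] .

lemma sum_from_component_component:
  assumes f: "f \<in> HE"
  shows "(\<lambda>w. \<Sum>t\<in>paths_lt E n. from_component t (component t f) w) = f"
proof
  fix w
  show "(\<Sum>t\<in>paths_lt E n. from_component t (component t f) w) = f w"
  proof (cases "w \<in> paths E")
    case True
    then obtain s p where sp: "s \<in> paths_lt E n" "p \<in> slot s" "w = glue s p"
      by (rule glue_cases)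
    have "(\<Sum>t\<in>paths_lt E n. from_component t (component t f) w)
        = (\<Sum>t\<in>paths_lt E n. if s = t then component t f p else 0)"
      using sp by (intro sum.cong) (simp_all add: from_component_glue)
    also have "\<dots> = f w"
      using sp finite_paths_lt by (simp add: component_apply)
    finally show ?thesis .
  next
    case False
    then show ?thesis using f by (simp add: from_component_outside ell2_outside)
  qed
qed

lemma vertex_path_lt: "vertex_path ` verts E \<subseteq> paths_lt E n"
  using n_pos by (auto simp: paths_lt_def vertex_path_path)

text \<open>Here \<open>V\<^sub>x\<^sup>* V\<^sub>x = P\<^sub>x\<close>, and the vertex projections sum to 1.  Since \<open>n \<ge> 1\<close>, vertices are short paths.\<close>

lemma sum_component_from_component:
  assumes f: "f \<in> HF"
  shows "(\<lambda>p. \<Sum>t\<in>vertex_path ` verts E. component t (from_component t f) p) = f"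
proof
  fix p
  have inj: "inj_on vertex_path (verts E)" by (auto simp: inj_on_def vertex_path_def)
  have "(\<Sum>t\<in>vertex_path ` verts E. component t (from_component t f) p)
      = (\<Sum>x\<in>verts E. component (vertex_path x) (from_component (vertex_path x) f) p)"
    by (simp add: sum.reindex[OF inj])
  also have "\<dots> = (\<Sum>x\<in>verts E. if x = prng F p then (if p \<in> paths F then f p else 0) else 0)"
    using vertex_path_lt by (intro sum.cong) (auto simp: component_from_component slot_def image_subset_iff)
  also have "\<dots> = f p"
    using F.prng_in_verts[of p] ell2_outside[OF f, of p] by auto
  finally show "(\<Sum>t\<in>vertex_path ` verts E. component t (from_component t f) p) = f p" .
qed

section \<open>Entries of periodic shifts\<close>

lemma creation_op_pcomp:
  assumes "v \<in> paths F" "g \<in> HF" "q \<in> paths F" "psrc v = prng F q"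
  shows "creation_op F v g (pcomp v q) = g q"
  using assms by (simp add: F.creation_op_eq)

lemma creation_op_outside:
  assumes "v \<in> paths F" "g \<in> HF" "\<And>q. q \<in> paths F \<Longrightarrow> psrc v = prng F q \<Longrightarrow> p \<noteq> pcomp v q"
  shows "creation_op F v g p = 0"
  using assms by (auto simp: F.creation_op_eq pull_def)

lemma creation_op_slot:
  assumes "v \<in> paths F" "g \<in> HF" "psrc s = prng F v" "p \<notin> slot s"
  shows "creation_op F v g p = 0"
  using assms by (intro creation_op_outside) (auto simp: slot_def prng_pcomp intro: F.pcomp_path)

lemma shift_op_pcomp:
  assumes "f \<in> HE" "w \<in> paths E" "tail E e = prng E w"
  shows "shift_op E lam e f (pcomp (edge_path E e) w) = lam (pcomp (edge_path E e) w) * f w"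
  using assms by (simp add: shift_op_eq)

lemma shift_op_outside:
  assumes "f \<in> HE" "\<And>w. w \<in> paths E \<Longrightarrow> tail E e = prng E w \<Longrightarrow> z \<noteq> pcomp (edge_path E e) w"
  shows "shift_op E lam e f z = 0"
  using assms by (auto simp: shift_op_eq pull_def)

lemma prng_glue: "p \<in> slot t \<Longrightarrow> prng E (glue t p) = prng E t"
  using flatten_path by (simp add: glue_def slot_def prng_pcomp)

lemma shift_op_from_component_zero:
  assumes t: "t \<in> paths_lt E n" and ne: "tail E e \<noteq> prng E t" and g: "g \<in> HF"
  shows "shift_op E lam e (from_component t g) = (\<lambda>_. 0)"
proof
  fix z
  show "shift_op E lam e (from_component t g) z = 0"
  proof (cases "\<exists>w\<in>paths E. tail E e = prng E w \<and> z = pcomp (edge_path E e) w")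
    case True
    then obtain w where w: "w \<in> paths E" "tail E e = prng E w" "z = pcomp (edge_path E e) w" by blast
    obtain s p where sp: "s \<in> paths_lt E n" "p \<in> slot s" "w = glue s p" by (rule glue_cases[OF w(1)])
    have "from_component t g w = 0" using sp ne w(2) t by (auto simp: from_component_glue prng_glue)
    then show ?thesis using w from_component_in[OF t g] by (simp add: shift_op_pcomp)
  next
    case False
    then show ?thesis by (intro shift_op_outside from_component_in t g) auto
  qed
qed

text \<open>Written \<open>T\<^sub>e V\<^sub>t = \<lambda>(et) V\<^sub>s L\<^sub>p\<close>, this covers two cases at once: if \<open>t\<close> has length
  less than \<open>n - 1\<close>, then \<open>et\<close> is still short, \<open>s = et\<close> and \<open>p\<close> is a vertex; otherwise \<open>et\<close> has length \<open>n\<close>,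
  \<open>s\<close> is a vertex and \<open>p\<close> is a single edge of the power graph.  On \<open>\<xi>\<^sub>q\<close> both sides give a multiple of the
  basis vector of \<open>etq = spq\<close>, and by periodicity the weight there is \<open>\<lambda>(et)\<close>.\<close>

lemma shift_op_from_component:
  assumes lam: "has_period E n lam" and e: "e \<in> arcs E" and t: "t \<in> paths_lt E n"
    and et: "tail E e = prng E t" and g: "g \<in> HF"
    and s: "s \<in> paths_lt E n" "p \<in> slot s" "pcomp (edge_path E e) t = glue s p"
  shows "shift_op E lam e (from_component t g)
    = (\<lambda>z. lam (pcomp (edge_path E e) t) * from_component s (creation_op F p g) z)"
proof
  fix z
  let ?e = "edge_path E e" and ?u = "pcomp (edge_path E e) t"
  have p: "p \<in> paths F" "psrc s = prng F p" using s(2) by (simp_all add: slot_def)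
  have st: "psrc p = psrc t" using s(3) by (metis glue_def psrc_flatten psrc_pcomp)
  have pq: "pcomp p q \<in> slot s" if "q \<in> slot t" for q
    using that p st by (auto simp: slot_def prng_pcomp intro: F.pcomp_path)
  have uq: "pcomp ?e (glue t q) = glue s (pcomp p q)" for q
    using s(3) by (simp add: glue_def flatten_pcomp flip: pcomp_assoc)
  show "shift_op E lam e (from_component t g) z = lam ?u * from_component s (creation_op F p g) z"
  proof (cases "\<exists>q\<in>slot t. z = glue s (pcomp p q)")
    case True
    then obtain q where q: "q \<in> slot t" "z = glue s (pcomp p q)" by blast
    have w: "glue t q \<in> paths E" "tail E e = prng E (glue t q)"
      using q(1) et glue_path[OF ltD[OF t]] by (simp_all add: prng_glue)
    have "path_rem E n (glue t q) = t"
      using path_rem_pcomp_flatten[OF t] q(1) by (simp add: glue_def slot_def)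
    then have "lam (pcomp ?e (glue t q)) = lam ?u"
      using has_period_rem[OF lam e w] by simp
    then have "shift_op E lam e (from_component t g) z = lam ?u * g q"
      using shift_op_pcomp[OF from_component_in[OF t g] w, of lam] t q by (simp add: from_component_glue uq)
    moreover have "from_component s (creation_op F p g) z = g q"
      unfolding q(2) using q(1) st
      by (simp add: from_component_glue[OF s(1) pq s(1)] creation_op_pcomp p(1) g slot_def)
    ultimately show ?thesis by simp
  next
    case False
    have "shift_op E lam e (from_component t g) z = 0"
    proof (cases "\<exists>w\<in>paths E. tail E e = prng E w \<and> z = pcomp ?e w")
      case True
      then obtain w where w: "w \<in> paths E" "tail E e = prng E w" "z = pcomp ?e w" by blast
      obtain s' q where sq: "s' \<in> paths_lt E n" "q \<in> slot s'" "w = glue s' q"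
        by (rule glue_cases[OF w(1)])
      have "s' \<noteq> t" using False sq(2) unfolding w(3) sq(3) by (auto simp only: uq)
      then have "from_component t g w = 0" using sq t by (simp add: from_component_glue)
      then show ?thesis using w from_component_in[OF t g] by (simp add: shift_op_pcomp)
    next
      case False
      then show ?thesis by (intro shift_op_outside from_component_in t g) auto
    qed
    moreover have "from_component s (creation_op F p g) z = 0"
    proof (cases "\<exists>q\<in>slot s. z = glue s q")
      case True
      then obtain q where q: "q \<in> slot s" "z = glue s q" by blast
      have "creation_op F p g q = 0"
      proof (rule creation_op_outside[OF p(1) g])
        fix r assume "r \<in> paths F" "psrc p = prng F r"
        then have "r \<in> slot t" by (simp add: slot_def flip: st)
        then show "q \<noteq> pcomp p r" using False q(2) by blast
      qed
      then show ?thesis using q s(1) by (simp add: from_component_glue)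
    qed (auto simp: from_component_def pull_def)
    ultimately show ?thesis by simp
  qed
qed

text \<open>Multiplying \<open>T\<^sub>e V\<^sub>t = \<lambda>(et) V\<^bsub>s0\<^esub> L\<^sub>p\<close> by \<open>V\<^sub>s\<^sup>*\<close> leaves \<open>\<lambda>(et) L\<^sub>p\<close> if \<open>s = s0\<close> and zero otherwise; the
  projection \<open>V\<^bsub>s0\<^esub>\<^sup>* V\<^bsub>s0\<^esub>\<close> is absorbed, because \<open>p\<close> ends at the source of \<open>s0\<close>.\<close>

lemma shift_op_entry:
  assumes lam: "has_period E n lam" and e: "e \<in> arcs E"
    and s: "s \<in> paths_lt E n" and t: "t \<in> paths_lt E n"
  shows "(\<lambda>g\<in>HF. component s (shift_op E lam e (from_component t g))) \<in> toeplitz_algebra F"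
proof -
  note cs = cstar_subalgebraD[OF F.cstar_toeplitz_algebra]
  have zero: "(\<lambda>g\<in>HF. component s (shift_op E lam e (from_component t g))) \<in> toeplitz_algebra F"
    if "\<And>g. g \<in> HF \<Longrightarrow> component s (shift_op E lam e (from_component t g)) = (\<lambda>_. 0)"
  proof -
    have "(\<lambda>g\<in>HF. component s (shift_op E lam e (from_component t g))) = zero_op HF"
      unfolding zero_op_def by (rule restrict_ext) (rule that)
    then show ?thesis using cs(2) by simp
  qed
  show ?thesis
  proof (cases "tail E e = prng E t")
    case False
    then show ?thesis
      using zero shift_op_from_component_zero[OF t False] by (simp add: component_apply fun_eq_iff)
  next
    case True
    have "pcomp (edge_path E e) t \<in> paths E"
      using True by (intro pcomp_path edge_path_path e ltD t) simp
    then obtain s0 p where s0: "s0 \<in> paths_lt E n" "p \<in> slot s0" "pcomp (edge_path E e) t = glue s0 p"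
      by (rule glue_cases)
    have p: "p \<in> paths F" "psrc s0 = prng F p" using s0(2) by (simp_all add: slot_def)
    let ?c = "lam (pcomp (edge_path E e) t)"
    have entry: "component s (shift_op E lam e (from_component t g)) q
        = ?c * (if s = s0 then creation_op F p g q else 0)" if g: "g \<in> HF" for g q
    proof -
      have "component s (shift_op E lam e (from_component t g)) q
          = ?c * component s (from_component s0 (creation_op F p g)) q"
        unfolding shift_op_from_component[OF lam e t True g s0] by (simp add: component_apply)
      also have "component s (from_component s0 (creation_op F p g)) q
          = (if s = s0 then creation_op F p g q else 0)"
        using creation_op_slot[OF p(1) g p(2)] by (simp add: component_from_component[OF s s0(1)])
      finally show ?thesis .
    qed
    show ?thesis
    proof (cases "s = s0")
      case True
      have "creation_op F p \<in> toeplitz_algebra F"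
        using p(1) cstar_generated_superset unfolding toeplitz_algebra_def by fast
      from cs(4)[OF this, of ?c]
      have "(\<lambda>g\<in>HF. \<lambda>q. ?c * creation_op F p g q) \<in> toeplitz_algebra F" .
      also have "(\<lambda>g\<in>HF. \<lambda>q. ?c * creation_op F p g q)
          = (\<lambda>g\<in>HF. component s (shift_op E lam e (from_component t g)))"
        using True by (intro restrict_ext ext) (simp add: entry[unfolded True])
      finally show ?thesis .
    next
      case False
      then show ?thesis by (intro zero) (simp add: entry fun_eq_iff)
    qed
  qed
qed

lemma periodic_shift_entry:
  assumes T: "T \<in> periodic_shift_algebra E n" and s: "s \<in> paths_lt E n" and t: "t \<in> paths_lt E n"
  shows "(\<lambda>g\<in>HF. component s (T (from_component t g))) \<in> toeplitz_algebra F"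
proof -
  let ?B = "{T \<in> bounded_ops HE. \<forall>s\<in>paths_lt E n. \<forall>t\<in>paths_lt E n.
    (\<lambda>g\<in>HF. component s (T (from_component t g))) \<in> toeplitz_algebra F}"
  have "cstar_subalgebra HE ?B"
    by (rule compressed_cstar_subalgebra[where R = component and R' = from_component,
          OF F.cstar_toeplitz_algebra component_adjoint order_refl sum_from_component_component])
  then have "periodic_shift_algebra E n \<subseteq> ?B"
    unfolding periodic_shift_algebra_def path_space_def
    by (rule cstar_generated_minimal) (auto intro: shift_op_bounded shift_op_entry)
  then show ?thesis using T s t by blast
qed

section \<open>Periodic shifts as matrices over the Toeplitz algebra\<close>

text \<open>Both sides send \<open>\<xi>\<^bsub>tr\<^esub>\<close> to \<open>\<xi>\<^bsub>svr\<^esub>\<close> if \<open>r\<close> is a path of the power graph whose range is the source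
  of both \<open>v\<close> and \<open>t\<close>, and vanish on all other basis vectors.\<close>

lemma from_component_creation_component:
  assumes v: "v \<in> paths F" and s: "s \<in> paths_lt E n" and t: "t \<in> paths_lt E n"
    and sv: "psrc s = prng F v"
  shows "(\<lambda>f\<in>HE. from_component s (creation_op F v (component t f)))
    = compose HE (prefix_op (glue s v)) (unprefix_op t)"
  unfolding compose_def
proof (rule restrict_ext, rule ext)
  fix f z assume f: "f \<in> HE"
  let ?D = "{q \<in> P. psrc (glue s v) = prng E q}"
  let ?g = "pull {q \<in> P. psrc t = prng E q} (pcomp t) f"
  have g: "?g \<in> HE"
    using f by (rule pull_ell2) (auto simp: inj_on_def)
  have src: "psrc (glue s v) = psrc v" by (simp add: glue_def)
  have cf: "component t f \<in> HF" by (rule component_in[OF t f])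
  have gf: "?g (flatten r) = component t f r" if "r \<in> paths F" for r
    using flatten_path[OF that] that by (auto simp: pull_def component_apply slot_def glue_def)
  have "from_component s (creation_op F v (component t f)) z = pull (pcomp (glue s v) ` ?D) (path_cut (glue s v)) ?g z"
  proof (cases "\<exists>r\<in>paths F. psrc v = prng F r \<and> z = glue s (pcomp v r)")
    case True
    then obtain r where r: "r \<in> paths F" "psrc v = prng F r" "z = glue s (pcomp v r)" by blast
    have m: "pcomp v r \<in> slot s" using r v sv by (auto simp: slot_def prng_pcomp intro: F.pcomp_path)
    have z: "z = pcomp (glue s v) (flatten r)"
      by (simp add: r(3) glue_def flatten_pcomp pcomp_assoc)
    have D: "flatten r \<in> ?D" using flatten_path[OF r(1)] r(2) by (simp add: src)
    have "from_component s (creation_op F v (component t f)) z = component t f r"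
      unfolding r(3) using r(1,2) by (simp add: from_component_glue[OF s m s] creation_op_pcomp v cf)
    also have "\<dots> = ?g (flatten r)" by (rule gf[OF r(1), symmetric])
    also have "\<dots> = pull (pcomp (glue s v) ` ?D) (path_cut (glue s v)) ?g z"
      unfolding z pull_path_cut_pcomp using D by (simp only: if_True)
    finally show ?thesis .
  next
    case False
    have "z \<notin> pcomp (glue s v) ` ?D"
    proof
      assume "z \<in> pcomp (glue s v) ` ?D"
      then obtain q where q: "q \<in> ?D" "z = pcomp (glue s v) q" by blast
      then have "q \<in> P" by simp
      then obtain r where r: "r \<in> paths F" "flatten r = q" by (rule flatten_surj)
      have "prng F r = psrc v" using flatten_path[OF r(1)] r(2) q(1) by (simp add: src)
      moreover have "z = glue s (pcomp v r)" using q(2) r(2) by (simp add: glue_def flatten_pcomp pcomp_assoc)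
      ultimately show False using False r(1) by auto
    qed
    moreover have "from_component s (creation_op F v (component t f)) z = 0"
    proof (cases "\<exists>q\<in>slot s. z = glue s q")
      case True
      then obtain q where q: "q \<in> slot s" "z = glue s q" by blast
      have "creation_op F v (component t f) q = 0"
        using False q by (intro creation_op_outside v cf) auto
      then show ?thesis using q s by (simp add: from_component_glue)
    qed (auto simp: from_component_def pull_def)
    ultimately show ?thesis by (simp add: pull_def)
  qed
  then show "from_component s (creation_op F v (component t f)) z = prefix_op (glue s v) (unprefix_op t f) z"
    using f g by (simp add: prefix_op_def unprefix_op_def)
qed

lemma from_component_toeplitz_component:
  assumes no_sinks: "\<forall>x\<in>verts E. \<exists>e\<in>arcs E. tail E e = x"
    and a: "a \<in> toeplitz_algebra F" and s: "s \<in> paths_lt E n" and t: "t \<in> paths_lt E n"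
  shows "(\<lambda>f\<in>HE. from_component s (a (component t f))) \<in> periodic_shift_algebra E n"
proof -
  note cs = cstar_subalgebraD[OF cstar_periodic_shift_algebra]
  let ?B = "{a \<in> bounded_ops HF. \<forall>s\<in>paths_lt E n. \<forall>t\<in>paths_lt E n.
    (\<lambda>f\<in>HE. from_component s (a (component t f))) \<in> periodic_shift_algebra E n}"
  have "(\<lambda>f\<in>HE. from_component s (creation_op F v (component t f))) \<in> periodic_shift_algebra E n"
    if v: "v \<in> paths F" and s: "s \<in> paths_lt E n" and t: "t \<in> paths_lt E n" for v s t
  proof (cases "psrc s = prng F v")
    case True
    then have "glue s v \<in> paths E" using v by (intro glue_path ltD s) (simp add: slot_def)
    then have "prefix_op (glue s v) \<in> periodic_shift_algebra E n"
      by (rule prefix_op_mem[OF no_sinks])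
    moreover have "unprefix_op t \<in> periodic_shift_algebra E n"
      by (rule cs(6)[OF prefix_op_mem[OF no_sinks ltD[OF t]] unprefix_op_bounded prefix_op_adjoint])
    ultimately show ?thesis
      unfolding from_component_creation_component[OF v s t True] by (rule cs(5))
  next
    case False
    have "from_component s (creation_op F v (component t f)) z = 0" if f: "f \<in> HE" for f z
    proof (cases "\<exists>q\<in>slot s. z = glue s q")
      case True
      then obtain q where q: "q \<in> slot s" "z = glue s q" by blast
      have "creation_op F v (component t f) q = 0"
        using False q(1)
        by (intro creation_op_outside v component_in t f) (auto simp: slot_def prng_pcomp)
      then show ?thesis using q s by (simp add: from_component_glue)
    qed (auto simp: from_component_def pull_def)
    then have "(\<lambda>f\<in>HE. from_component s (creation_op F v (component t f))) = zero_op HE"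
      unfolding zero_op_def by (intro restrict_ext ext) auto
    then show ?thesis using cs(2) by simp
  qed
  moreover have "cstar_subalgebra HF ?B"
    by (rule compressed_cstar_subalgebra[where R = from_component and R' = component,
          OF cstar_periodic_shift_algebra from_component_adjoint vertex_path_lt sum_component_from_component])
  ultimately have "toeplitz_algebra F \<subseteq> ?B"
    unfolding toeplitz_algebra_def path_space_def
    by (intro cstar_generated_minimal) (auto intro: F.creation_op_bounded)
  then show ?thesis using a s t by blast
qed

definition matrix_on_paths where
  "matrix_on_paths a =
    (\<lambda>f\<in>HE. \<lambda>w. \<Sum>s\<in>paths_lt E n. \<Sum>t\<in>paths_lt E n. from_component s (a s t (component t f)) w)"

text \<open>An operator \<open>T\<close> is recovered from its entries as \<open>\<Sum>\<^bsub>s,t\<^esub> V\<^sub>s (V\<^sub>s\<^sup>* T V\<^sub>t) V\<^sub>t\<^sup>*\<close>.\<close>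

lemma periodic_shift_algebra_eq_matrices:
  assumes no_sinks: "\<forall>x\<in>verts E. \<exists>e\<in>arcs E. tail E e = x"
  shows "periodic_shift_algebra E n =
    {matrix_on_paths a | a. \<forall>s\<in>paths_lt E n. \<forall>t\<in>paths_lt E n. a s t \<in> toeplitz_algebra F}"
proof (intro subset_antisym subsetI)
  fix T assume T: "T \<in> periodic_shift_algebra E n"
  then have Tb: "T \<in> bounded_ops HE"
    using cstar_subalgebraD(1)[OF cstar_periodic_shift_algebra] by blast
  let ?a = "\<lambda>s t. \<lambda>g\<in>HF. component s (T (from_component t g))"
  have "matrix_on_paths ?a f = T f" for f
  proof (cases "f \<in> HE")
    case f: True
    let ?h = "\<lambda>t. T (from_component t (component t f))"
    have h: "?h t \<in> HE" if "t \<in> paths_lt E n" for t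
      by (intro bounded_opsD(1)[OF Tb] from_component_in component_in that f)
    have "matrix_on_paths ?a f w = T f w" for w
    proof -
      have "matrix_on_paths ?a f w
          = (\<Sum>s\<in>paths_lt E n. \<Sum>t\<in>paths_lt E n. from_component s (component s (?h t)) w)"
        using f by (simp add: matrix_on_paths_def component_in)
      also have "\<dots> = (\<Sum>t\<in>paths_lt E n. \<Sum>s\<in>paths_lt E n. from_component s (component s (?h t)) w)"
        by (rule sum.swap)
      also have "\<dots> = (\<Sum>t\<in>paths_lt E n. ?h t w)"
        by (intro sum.cong refl fun_cong[OF sum_from_component_component[OF h]])
      also have "\<dots> = T (\<lambda>w. \<Sum>t\<in>paths_lt E n. from_component t (component t f) w) w"
        by (subst linear_on_sum[OF bounded_opsD(3)[OF Tb]]) (auto intro: from_component_in component_in f)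
      finally show ?thesis by (simp add: sum_from_component_component[OF f])
    qed
    then show ?thesis by auto
  qed (simp add: matrix_on_paths_def bounded_opsD(2)[OF Tb])
  then have "T = matrix_on_paths ?a" by auto
  then show "T \<in> {matrix_on_paths a | a.
      \<forall>s\<in>paths_lt E n. \<forall>t\<in>paths_lt E n. a s t \<in> toeplitz_algebra F}"
    using periodic_shift_entry[OF T] by blast
next
  fix T assume "T \<in> {matrix_on_paths a | a.
      \<forall>s\<in>paths_lt E n. \<forall>t\<in>paths_lt E n. a s t \<in> toeplitz_algebra F}"
  then obtain a where T: "T = matrix_on_paths a"
    and a: "\<And>s t. s \<in> paths_lt E n \<Longrightarrow> t \<in> paths_lt E n \<Longrightarrow> a s t \<in> toeplitz_algebra F"
    by blast
  have "(\<lambda>f\<in>HE. \<lambda>w. \<Sum>s\<in>paths_lt E n. (\<lambda>f\<in>HE. \<lambda>w. \<Sum>t\<in>paths_lt E n.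
      (\<lambda>f\<in>HE. from_component s (a s t (component t f))) f w) f w) \<in> periodic_shift_algebra E n"
    by (intro cstar_sum[OF cstar_periodic_shift_algebra] from_component_toeplitz_component[OF no_sinks] a)
  also have "(\<lambda>f\<in>HE. \<lambda>w. \<Sum>s\<in>paths_lt E n. (\<lambda>f\<in>HE. \<lambda>w. \<Sum>t\<in>paths_lt E n.
      (\<lambda>f\<in>HE. from_component s (a s t (component t f))) f w) f w) = T"
    unfolding T matrix_on_paths_def by (rule restrict_ext) simp
  finally show "T \<in> periodic_shift_algebra E n" .
qed

section \<open>The unitary and the corner\<close>

text \<open>A numbering of the short paths with source \<open>x\<close> by the indices \<open>(x, i)\<close> of the direct sum.\<close>

definition labelling :: "('a \<times> nat \<Rightarrow> ('a, 'b) path) \<Rightarrow> bool" where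
  "labelling \<tau> \<longleftrightarrow> bij_betw \<tau> (copies E n) (paths_lt E n) \<and> (\<forall>j\<in>copies E n. psrc (\<tau> j) = fst j)"

lemma labelling_exists: "\<exists>\<tau>. labelling \<tau>"
proof -
  let ?L = "\<lambda>x. {w \<in> paths_lt E n. psrc w = x}"
  have "\<exists>h. bij_betw h {..<num_paths_lt E n x} (?L x)" for x
    using ex_bij_betw_nat_finite[of "?L x"] finite_subset[OF _ finite_paths_lt, of "?L x" n]
    by (auto simp: num_paths_lt_def lessThan_atLeast0)
  then obtain h where h: "\<And>x. bij_betw (h x) {..<num_paths_lt E n x} (?L x)" by metis
  define \<tau> where "\<tau> = (\<lambda>(x, i). h x i)"
  have mem: "\<tau> j \<in> paths_lt E n \<and> psrc (\<tau> j) = fst j" if "j \<in> copies E n" for j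
    using that bij_betw_apply[OF h] by (fastforce simp: copies_def \<tau>_def)
  have "inj_on \<tau> (copies E n)"
  proof (rule inj_onI)
    fix j k assume j: "j \<in> copies E n" and k: "k \<in> copies E n" and eq: "\<tau> j = \<tau> k"
    have "fst j = fst k" using mem[OF j] mem[OF k] eq by simp
    moreover have "snd j = snd k"
      using inj_onD[OF bij_betw_imp_inj_on[OF h[of "fst j"]], of "snd j" "snd k"] j k eq calculation
      by (auto simp: copies_def \<tau>_def split_beta)
    ultimately show "j = k" by (simp add: prod_eq_iff)
  qed
  moreover have "w \<in> \<tau> ` copies E n" if w: "w \<in> paths_lt E n" for w
  proof -
    have "w \<in> h (psrc w) ` {..<num_paths_lt E n (psrc w)}"
      using bij_betw_imp_surj_on[OF h] w by simp
    then obtain i where i: "i \<in> {..<num_paths_lt E n (psrc w)}" and hi: "h (psrc w) i = w"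
      by (rule imageE) simp
    have "(psrc w, i) \<in> copies E n"
      using i psrc_in_verts[OF ltD[OF w]] by (simp add: copies_def)
    moreover have "\<tau> (psrc w, i) = w" by (simp add: \<tau>_def hi)
    ultimately show ?thesis by (metis imageI)
  qed
  ultimately have "labelling \<tau>" using mem unfolding labelling_def bij_betw_def by blast
  then show ?thesis by blast
qed

definition component_space :: "(('a \<times> nat) \<times> ('a, ('a, 'b) path \<times> 'a) path \<Rightarrow> complex) set" where
  "component_space = direct_sum (copies E n) (\<lambda>(x, i). vertex_proj F x ` HF)"

definition to_components :: "('a \<times> nat \<Rightarrow> ('a, 'b) path) \<Rightarrow> (('a, 'b) path \<Rightarrow> complex) \<Rightarrow>
    (('a \<times> nat) \<times> ('a, ('a, 'b) path \<times> 'a) path \<Rightarrow> complex)" where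
  "to_components \<tau> f = (\<lambda>(j, p). if j \<in> copies E n then component (\<tau> j) f p else 0)"

lemma finite_copies: "finite (copies E n)"
  by (simp add: copies_def)

lemma vertex_proj_range:
  assumes "x \<in> verts E"
  shows "vertex_proj F x ` HF = {g \<in> HF. \<forall>p. prng F p \<noteq> x \<longrightarrow> g p = 0}"
proof (intro subset_antisym subsetI)
  fix g assume "g \<in> vertex_proj F x ` HF"
  then obtain f where f: "f \<in> HF" "g = vertex_proj F x f" by blast
  have "g = pull {p \<in> paths F. prng F p = x} (\<lambda>p. p) f"
    using f assms by (auto simp: F.vertex_proj_apply pull_def)
  moreover have "pull {p \<in> paths F. prng F p = x} (\<lambda>p. p) f \<in> HF"
    by (rule pull_ell2[OF f(1)]) auto
  ultimately show "g \<in> {g \<in> HF. \<forall>p. prng F p \<noteq> x \<longrightarrow> g p = 0}" by (auto simp: pull_def)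
next
  fix g assume g: "g \<in> {g \<in> HF. \<forall>p. prng F p \<noteq> x \<longrightarrow> g p = 0}"
  then have g1: "g \<in> HF" and g2: "\<And>p. prng F p \<noteq> x \<Longrightarrow> g p = 0" by blast+
  have "vertex_proj F x g p = g p" for p
    using F.vertex_proj_apply[of x g p] assms g1 g2[of p] ell2_outside[OF g1, of p] by auto
  then have "g = vertex_proj F x g" by auto
  then show "g \<in> vertex_proj F x ` HF" using g by blast
qed

lemma component_space_iff:
  "h \<in> component_space \<longleftrightarrow> (\<forall>j\<in>copies E n. (\<lambda>p. h (j, p)) \<in> HF \<and> (\<forall>p. prng F p \<noteq> fst j \<longrightarrow> h (j, p) = 0)) \<and>
    (\<forall>j p. j \<notin> copies E n \<longrightarrow> h (j, p) = 0)"
proof -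
  have "(\<lambda>p. h (j, p)) \<in> (\<lambda>(x, i). vertex_proj F x ` HF) j \<longleftrightarrow>
      (\<lambda>p. h (j, p)) \<in> HF \<and> (\<forall>p. prng F p \<noteq> fst j \<longrightarrow> h (j, p) = 0)"
    if "j \<in> copies E n" for j
    using that vertex_proj_range[of "fst j"] by (cases j) (simp add: copies_def)
  then show ?thesis by (simp add: component_space_def direct_sum_def)
qed

lemma slot_labelling:
  assumes "labelling \<tau>" "j \<in> copies E n"
  shows "p \<in> slot (\<tau> j) \<longleftrightarrow> p \<in> paths F \<and> prng F p = fst j"
  using assms by (auto simp: slot_def labelling_def)

lemma labelling_lt: "labelling \<tau> \<Longrightarrow> j \<in> copies E n \<Longrightarrow> \<tau> j \<in> paths_lt E n"
  by (auto simp: labelling_def bij_betw_def)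

text \<open>As a map of basis vectors this is \<open>\<xi>\<^bsub>tp\<^esub> \<mapsto> \<xi>\<^bsub>(j,p)\<^esub>\<close> for \<open>t = \<tau> j\<close>, a bijection by unique
  factorization, so inner products are preserved by reindexing.  The preimage of \<open>h\<close> is
  \<open>\<Sum>\<^sub>k V\<^bsub>\<tau> k\<^esub> h\<^sub>k\<close>, a finite sum.\<close>

lemma to_components_unitary:
  assumes \<tau>: "labelling \<tau>"
  shows "is_unitary HE component_space (to_components \<tau>)"
proof -
  let ?J = "copies E n"
  let ?D = "SIGMA j:?J. slot (\<tau> j)" and ?\<beta> = "\<lambda>(j, p). glue (\<tau> j) p"
  have U: "to_components \<tau> = pull ?D ?\<beta>"
    by (auto simp: to_components_def pull_def component_apply fun_eq_iff)
  have \<beta>: "bij_betw ?\<beta> ?D (paths E)"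
    unfolding bij_betw_def
  proof (intro conjI subset_antisym subsetI)
    have inj: "inj_on \<tau> ?J" using \<tau> by (auto simp: labelling_def bij_betw_def)
    show "inj_on ?\<beta> ?D"
      by (auto simp: inj_on_def glue_inject labelling_lt[OF \<tau>] simp del: split_paired_All
          dest: inj_onD[OF inj])
  next
    fix w assume "w \<in> ?\<beta> ` ?D"
    then show "w \<in> paths E" using glue_path[OF ltD[OF labelling_lt[OF \<tau>]]] by auto
  next
    fix w assume "w \<in> paths E"
    then obtain s p where sp: "s \<in> paths_lt E n" "p \<in> slot s" "w = glue s p" by (rule glue_cases)
    then obtain j where "j \<in> ?J" "s = \<tau> j"
      using \<tau> unfolding labelling_def bij_betw_def by blast
    then show "w \<in> ?\<beta> ` ?D" using sp by (intro image_eqI[of _ _ "(j, p)"]) auto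
  qed
  have inner: "l2_inner (to_components \<tau> f) (to_components \<tau> g) = l2_inner f g" if f: "f \<in> HE" for f g
  proof -
    have "l2_inner (to_components \<tau> f) (to_components \<tau> g) = (\<Sum>\<^sub>\<infinity>i\<in>?D. f (?\<beta> i) * cnj (g (?\<beta> i)))"
      unfolding l2_inner_def U by (rule infsum_cong_neutral) (auto simp: pull_def)
    also have "\<dots> = (\<Sum>\<^sub>\<infinity>w\<in>paths E. f w * cnj (g w))"
      by (rule infsum_reindex_bij_betw[OF \<beta>, of "\<lambda>w. f w * cnj (g w)"])
    also have "\<dots> = l2_inner f g"
      unfolding l2_inner_def using ell2_outside[OF f] by (intro infsum_cong_neutral) auto
    finally show ?thesis .
  qed
  have into: "to_components \<tau> f \<in> component_space" if f: "f \<in> HE" for f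
  proof -
    have c: "(\<lambda>p. component (\<tau> j) f p) \<in> HF" if "j \<in> ?J" for j
      using component_in[OF labelling_lt[OF \<tau> that] f] by simp
    show ?thesis
      unfolding component_space_iff to_components_def
      using c slot_labelling[OF \<tau>] by (auto simp: component_apply)
  qed
  have inj: "inj_on (to_components \<tau>) HE"
  proof (rule inj_onI)
    fix f g assume f: "f \<in> HE" and g: "g \<in> HE" and eq: "to_components \<tau> f = to_components \<tau> g"
    show "f = g"
    proof
      fix w show "f w = g w"
      proof (cases "w \<in> paths E")
        case True
        then obtain d where d: "d \<in> ?D" "w = ?\<beta> d" 
          using bij_betw_imp_surj_on[OF \<beta>] by blast
        have "to_components \<tau> f d = to_components \<tau> g d" using eq by simp
        then show ?thesis using d unfolding U by (simp add: pull_def)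
      qed (use ell2_outside f g in metis)
    qed
  qed
  have surj: "h \<in> to_components \<tau> ` HE" if h: "h \<in> component_space" for h
  proof -
    define f where "f = (\<lambda>w. \<Sum>k\<in>?J. from_component (\<tau> k) (\<lambda>p. h (k, p)) w)"
    have "f \<in> HE"
      unfolding f_def using h
      by (intro ell2_sum from_component_in labelling_lt[OF \<tau>]) (auto simp: component_space_iff)
    moreover have "to_components \<tau> f (j, p) = h (j, p)" for j p
    proof (cases "j \<in> ?J \<and> p \<in> slot (\<tau> j)")
      case True
      then have j: "j \<in> ?J" and p: "p \<in> slot (\<tau> j)" by auto
      have "to_components \<tau> f (j, p) = (\<Sum>k\<in>?J. from_component (\<tau> k) (\<lambda>p. h (k, p)) (glue (\<tau> j) p))"
        using j p by (simp add: to_components_def component_apply f_def)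
      also have "\<dots> = (\<Sum>k\<in>?J. if j = k then h (k, p) else 0)"
      proof (rule sum.cong[OF refl])
        fix k assume k: "k \<in> ?J"
        have "\<tau> j = \<tau> k \<longleftrightarrow> j = k"
          using \<tau> j k by (auto simp: labelling_def bij_betw_def dest: inj_onD)
        then show "from_component (\<tau> k) (\<lambda>p. h (k, p)) (glue (\<tau> j) p) = (if j = k then h (k, p) else 0)"
          using from_component_glue[OF labelling_lt[OF \<tau> j] p labelling_lt[OF \<tau> k]] by simp
      qed
      also have "\<dots> = h (j, p)" using j finite_copies by simp
      finally show ?thesis .
    next
      case False
      have "h (j, p) = 0"
      proof (cases "j \<in> ?J")
        case j: True
        then have "(\<lambda>p. h (j, p)) \<in> HF" "prng F p \<noteq> fst j \<Longrightarrow> h (j, p) = 0"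
          using h unfolding component_space_iff by blast+
        then show ?thesis 
          using False j slot_labelling[OF \<tau> j, of p] ell2_outside[of "\<lambda>p. h (j, p)" "paths F" p] by blast
      next
        case False
        then show ?thesis using h unfolding component_space_iff by blast
      qed
      then show ?thesis using False by (simp add: to_components_def component_apply)
    qed
    then have "h = to_components \<tau> f" by auto
    ultimately show ?thesis by blast
  qed
  show ?thesis
    unfolding is_unitary_def
  proof (intro conjI ballI)
    show "bij_betw (to_components \<tau>) HE component_space"
      unfolding bij_betw_def using inj into surj by blast
    show "linear_on HE (to_components \<tau>)" unfolding U by (rule pull_linear)
  qed (rule inner)
qed

text \<open>For \<open>h = U f\<close> the \<open>k\<close>-th component of \<open>h\<close> is \<open>V\<^bsub>\<tau> k\<^esub>\<^sup>* f\<close>, so both sides have \<open>j\<close>-th component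
  \<open>P \<Sum>\<^sub>k b\<^bsub>jk\<^esub> V\<^bsub>\<tau> k\<^esub>\<^sup>* f\<close>, where \<open>P\<close> is the vertex projection of the source of \<open>\<tau> j\<close>: on the left it arises as
  \<open>V\<^bsub>\<tau> j\<^esub>\<^sup>* V\<^bsub>\<tau> j\<^esub>\<close>, on the right as the diagonal entry of \<open>Q\<close>.\<close>

lemma conjugate_matrix:
  assumes \<tau>: "labelling \<tau>"
    and a: "\<forall>s\<in>paths_lt E n. \<forall>t\<in>paths_lt E n. a s t \<in> toeplitz_algebra F"
    and b: "\<And>j k. j \<in> copies E n \<Longrightarrow> k \<in> copies E n \<Longrightarrow> b j k = a (\<tau> j) (\<tau> k)"
  defines "Q \<equiv> diagonal_op (copies E n) HF (\<lambda>(x, i). vertex_proj F x)"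
  shows "(\<lambda>g\<in>component_space. to_components \<tau> (matrix_on_paths a (inv_into HE (to_components \<tau>) g)))
    = (\<lambda>h\<in>component_space. Q (matrix_op (copies E n) HF b (Q h)))"
proof (rule restrict_ext)
  let ?J = "copies E n"
  fix h assume h: "h \<in> component_space"
  have bij: "bij_betw (to_components \<tau>) HE component_space"
    using to_components_unitary[OF \<tau>] by (simp add: is_unitary_def)
  define f where "f = inv_into HE (to_components \<tau>) h"
  have f: "f \<in> HE" and Uf: "to_components \<tau> f = h"
    using bij h by (auto simp: f_def bij_betw_def inv_into_into f_inv_into_f)
  have hk: "(\<lambda>p. h (k, p)) = component (\<tau> k) f" if "k \<in> ?J" for k
    using that Uf[symmetric] by (simp add: to_components_def)
  have hF: "(\<lambda>p. h (k, p)) \<in> HF" if "k \<in> ?J" for k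
    using that h by (simp add: component_space_iff)
  have hsum: "h \<in> direct_sum ?J (\<lambda>_. HF)"
    using h by (auto simp: direct_sum_def component_space_iff)
  \<comment> \<open>On the direct sum of full copies, \<open>Q\<close> cuts each component down to its slot.\<close>
  have diag: "Q g (j, p) = (if j \<in> ?J \<and> p \<in> slot (\<tau> j) then g (j, p) else 0)"
    if g: "g \<in> direct_sum ?J (\<lambda>_. HF)" for g j p
  proof (cases "j \<in> ?J")
    case j: True
    have gj: "(\<lambda>p. g (j, p)) \<in> HF" and gk: "\<And>k. k \<in> ?J \<Longrightarrow> (\<lambda>p. g (k, p)) \<in> HF"
      using g j by (auto simp: direct_sum_def)
    have fv: "fst j \<in> verts F" using j by (auto simp: copies_def)
    have "Q g (j, p) = (\<Sum>k\<in>?J. if j = k then vertex_proj F (fst j) (\<lambda>p. g (j, p)) p else 0)"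
      unfolding Q_def diagonal_op_def matrix_op_def using g j gk
      by (auto simp: zero_op_def split_beta intro!: sum.cong)
    also have "\<dots> = vertex_proj F (fst j) (\<lambda>p. g (j, p)) p"
      using j finite_copies by simp
    also have "\<dots> = (if p \<in> slot (\<tau> j) then g (j, p) else 0)"
      using F.vertex_proj_apply[OF fv gj, of p] slot_labelling[OF \<tau> j, of p] by simp
    finally show ?thesis using j by simp
  qed (use g in \<open>simp add: Q_def diagonal_op_def matrix_op_def\<close>)
  have "Q h = h"
  proof
    fix i :: "('a \<times> nat) \<times> ('a, ('a, 'b) path \<times> 'a) path"
    obtain j p where i: "i = (j, p)" by (cases i)
    have "h (j, p) = 0" if "\<not> (j \<in> ?J \<and> p \<in> slot (\<tau> j))"
      using that h Uf[symmetric] by (auto simp: to_components_def component_apply)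
    then show "Q h i = h i" unfolding i diag[OF hsum] by auto
  qed
  have bt: "b j k \<in> bounded_ops HF" if "j \<in> ?J" "k \<in> ?J" for j k
  proof -
    have "a (\<tau> j) (\<tau> k) \<in> toeplitz_algebra F" using a labelling_lt[OF \<tau>] that by blast
    then show ?thesis
      using b[OF that] cstar_subalgebraD(1)[OF F.cstar_toeplitz_algebra] by auto
  qed
  let ?X = "matrix_op ?J HF b h"
  have X: "?X (j, p) = (if j \<in> ?J then \<Sum>k\<in>?J. b j k (\<lambda>p. h (k, p)) p else 0)" for j p
    using hsum by (simp add: matrix_op_def)
  have "(\<lambda>p. \<Sum>k\<in>?J. b j k (\<lambda>p. h (k, p)) p) \<in> HF" if "j \<in> ?J" for j
    by (intro ell2_sum bounded_opsD(1)[OF bt] that hF)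
  then have Xsum: "?X \<in> direct_sum ?J (\<lambda>_. HF)"
    by (auto simp: direct_sum_def X cong: if_cong)
  have "to_components \<tau> (matrix_on_paths a f) (j, p) = Q ?X (j, p)" for j p
  proof (cases "j \<in> ?J \<and> p \<in> slot (\<tau> j)")
    case True
    then have j: "j \<in> ?J" and p: "p \<in> slot (\<tau> j)" by auto
    have lt: "\<tau> j \<in> paths_lt E n" by (rule labelling_lt[OF \<tau> j])
    have "to_components \<tau> (matrix_on_paths a f) (j, p) = (\<Sum>s\<in>paths_lt E n. \<Sum>t\<in>paths_lt E n.
        from_component s (a s t (component t f)) (glue (\<tau> j) p))"
      using j p f by (simp add: to_components_def component_apply matrix_on_paths_def)
    also have "\<dots> = (\<Sum>s\<in>paths_lt E n. if \<tau> j = s then \<Sum>t\<in>paths_lt E n. a s t (component t f) p else 0)"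
      using from_component_glue[OF lt p] by (intro sum.cong) simp_all
    also have "\<dots> = (\<Sum>t\<in>paths_lt E n. a (\<tau> j) t (component t f) p)"
      using lt finite_paths_lt by simp
    also have "\<dots> = (\<Sum>k\<in>?J. a (\<tau> j) (\<tau> k) (component (\<tau> k) f) p)"
      using \<tau> by (intro sum.reindex_bij_betw[symmetric]) (simp add: labelling_def)
    also have "\<dots> = (\<Sum>k\<in>?J. b j k (\<lambda>p. h (k, p)) p)"
      by (intro sum.cong) (simp_all add: b j hk)
    also have "\<dots> = Q ?X (j, p)"
      unfolding diag[OF Xsum] using j p by (simp add: X)
    finally show ?thesis .
  next
    case False
    then show ?thesis unfolding diag[OF Xsum] by (auto simp: to_components_def component_apply)
  qed
  then show "to_components \<tau> (matrix_on_paths a (inv_into HE (to_components \<tau>) h)) = Q (matrix_op ?J HF b (Q h))"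
    unfolding \<open>Q h = h\<close> f_def[symmetric] by (intro ext) (metis prod.collapse)
qed

end

theorem theorem5p5:
  fixes E :: "('a, 'b) pre_digraph" and n :: nat
  assumes "fin_digraph E"
    and no_sinks: "\<forall>x\<in>verts E. \<exists>e\<in>arcs E. tail E e = x"
    and no_sources: "\<forall>x\<in>verts E. \<exists>e\<in>arcs E. head E e = x"
    and "n \<ge> 1"
  shows "let F = power_graph E n;
             J = copies E n;
             H = path_space F;
             Q = diagonal_op J H (\<lambda>(x, i). vertex_proj F x);
             K = direct_sum J (\<lambda>(x, i). vertex_proj F x ` H)
         in unitarily_equivalent
              (path_space E) (periodic_shift_algebra E n)
              K (corner K Q (matrix_algebra J H (toeplitz_algebra F)))"
proof -
  interpret power_graph_setting E n
    using assms(1,4) by (simp add: power_graph_setting_def power_graph_setting_axioms_def)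
  obtain \<tau> where \<tau>: "labelling \<tau>" using labelling_exists by blast
  let ?J = "copies E n" and ?Q = "diagonal_op (copies E n) HF (\<lambda>(x, i). vertex_proj F x)"
  let ?conj = "\<lambda>T. \<lambda>g\<in>component_space. to_components \<tau> (T (inv_into HE (to_components \<tau>) g))"
  have "?conj ` periodic_shift_algebra E n
      = corner component_space ?Q (matrix_algebra ?J HF (toeplitz_algebra F))"
  proof (intro subset_antisym subsetI)
    fix T assume "T \<in> ?conj ` periodic_shift_algebra E n"
    then obtain a where a: "\<forall>s\<in>paths_lt E n. \<forall>t\<in>paths_lt E n. a s t \<in> toeplitz_algebra F"
      and T: "T = ?conj (matrix_on_paths a)"
      unfolding periodic_shift_algebra_eq_matrices[OF no_sinks] by blast
    let ?b = "\<lambda>j k. a (\<tau> j) (\<tau> k)"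
    have "matrix_op ?J HF ?b \<in> matrix_algebra ?J HF (toeplitz_algebra F)"
      using a labelling_lt[OF \<tau>] unfolding matrix_algebra_def by blast
    then show "T \<in> corner component_space ?Q (matrix_algebra ?J HF (toeplitz_algebra F))"
      unfolding T conjugate_matrix[OF \<tau> a refl] corner_def by blast
  next
    fix T assume "T \<in> corner component_space ?Q (matrix_algebra ?J HF (toeplitz_algebra F))"
    then obtain b where b: "\<forall>j\<in>?J. \<forall>k\<in>?J. b j k \<in> toeplitz_algebra F"
      and T: "T = (\<lambda>h\<in>component_space. ?Q (matrix_op ?J HF b (?Q h)))"
      unfolding corner_def matrix_algebra_def by blast
    let ?a = "\<lambda>s t. b (inv_into ?J \<tau> s) (inv_into ?J \<tau> t)"
    have bij: "bij_betw \<tau> ?J (paths_lt E n)" using \<tau> by (simp add: labelling_def)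
    have a: "\<forall>s\<in>paths_lt E n. \<forall>t\<in>paths_lt E n. ?a s t \<in> toeplitz_algebra F"
      using b bij_betw_apply[OF bij_betw_inv_into[OF bij]] by blast
    have "T = ?conj (matrix_on_paths ?a)"
      unfolding T
      by (rule conjugate_matrix[OF \<tau> a, symmetric]) (simp add: bij_betw_inv_into_left[OF bij])
    then show "T \<in> ?conj ` periodic_shift_algebra E n"
      unfolding periodic_shift_algebra_eq_matrices[OF no_sinks] using a by blast
  qed
  then have "unitarily_equivalent HE (periodic_shift_algebra E n) component_space
      (corner component_space ?Q (matrix_algebra ?J HF (toeplitz_algebra F)))"
    unfolding unitarily_equivalent_def using to_components_unitary[OF \<tau>] by blast
  then show ?thesis by (simp add: Let_def path_space_def component_space_def)
qed

end
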